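(* (In $\mathsf{ZF}$.) For every set $A$, if $\mathscr{B}(A)$ is Dedekind infinite, then there is no Dedekind finite-to-one function from $\mathscr{B}(A)$ to $\mathrm{fin}(A)$.
   Context: Work in $\mathsf{ZF}$ (no axiom of choice). A partition is finitary if all its blocks are finite; $\mathscr{B}(A)$ is the set of finitary partitions of $A$. $\mathrm{fin}(A)$ is the set of finite subsets of $A$. A set $X$ is Dedekind infinite if there is an injection from $\omega$ into $X$, otherwise Dedekind finite. A function $f$ is Dedekind finite-to-one if $f^{-1}[\{z\}]$ is Dedekind finite for every $z\in\mathrm{ran}(f)$. *)

theory Defs
  imports Main
begin

text \<open>
  HOL proves the axiom of choice, so a theorem of ZF without choice cannot be stated about HOL
  sets without losing its content.  Instead we work inside an arbitrary model of first-order ZF: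
  a type \<open>'v\<close> of ``sets'' with a membership relation satisfying the axioms, where Separation and
  Replacement range over first-order formulas (with parameters) only.  If the schemas ranged over
  arbitrary HOL predicates, Hilbert choice would make every model satisfy the axiom of choice.
  All set-theoretic notions, including finiteness and \<open>\<omega>\<close>, are those of the model.
\<close>

section \<open>First-order formulas of set theory\<close>

text \<open>Variables are de Bruijn indices; \<open>case_nat a e\<close> is the assignment \<open>e\<close> with \<open>a\<close> put in
  front.\<close>

datatype fm = Mem nat nat | Eq nat nat | Neg fm | Conj fm fm | All fm

primrec sat :: "('v \<Rightarrow> 'v \<Rightarrow> bool) \<Rightarrow> (nat \<Rightarrow> 'v) \<Rightarrow> fm \<Rightarrow> bool" where
  "sat mem e (Mem i j) \<longleftrightarrow> mem (e i) (e j)"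
| "sat mem e (Eq i j) \<longleftrightarrow> e i = e j"
| "sat mem e (Neg \<phi>) \<longleftrightarrow> \<not> sat mem e \<phi>"
| "sat mem e (Conj \<phi> \<psi>) \<longleftrightarrow> sat mem e \<phi> \<and> sat mem e \<psi>"
| "sat mem e (All \<phi>) \<longleftrightarrow> (\<forall>a. sat mem (case_nat a e) \<phi>)"

section \<open>Set-theoretic notions of a membership structure\<close>

locale set_structure =
  fixes mem :: "'v \<Rightarrow> 'v \<Rightarrow> bool" (infix "\<epsilon>" 50)
begin

text \<open>\<open>coll P\<close> is the set \<open>{x. P x}\<close> of the structure.  It is meaningful only if this class is a
  set; in a model of ZF this is the case for each use below (see the lemmas \<open>mem_\<dots>\<close> at the end
  of this theory).\<close>

definition coll :: "('v \<Rightarrow> bool) \<Rightarrow> 'v" where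
  "coll P = (THE z. \<forall>x. x \<epsilon> z \<longleftrightarrow> P x)"

definition subset :: "'v \<Rightarrow> 'v \<Rightarrow> bool" where
  "subset x y \<longleftrightarrow> (\<forall>z. z \<epsilon> x \<longrightarrow> z \<epsilon> y)"

definition upair :: "'v \<Rightarrow> 'v \<Rightarrow> 'v" where
  "upair a b = coll (\<lambda>x. x = a \<or> x = b)"

definition opair :: "'v \<Rightarrow> 'v \<Rightarrow> 'v" where
  "opair a b = upair (upair a a) (upair a b)"

definition is_inductive :: "'v \<Rightarrow> bool" where
  "is_inductive I \<longleftrightarrow>
     (\<exists>z. (\<forall>x. \<not> x \<epsilon> z) \<and> z \<epsilon> I) \<and>
     (\<forall>x. x \<epsilon> I \<longrightarrow> (\<exists>y. (\<forall>w. w \<epsilon> y \<longleftrightarrow> w \<epsilon> x \<or> w = x) \<and> y \<epsilon> I))"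

definition omega :: 'v where
  "omega = coll (\<lambda>n. \<forall>I. is_inductive I \<longrightarrow> n \<epsilon> I)"

definition is_function :: "'v \<Rightarrow> 'v \<Rightarrow> 'v \<Rightarrow> bool" where
  "is_function f X Y \<longleftrightarrow>
     (\<forall>p. p \<epsilon> f \<longrightarrow> (\<exists>x y. x \<epsilon> X \<and> y \<epsilon> Y \<and> p = opair x y)) \<and>
     (\<forall>x. x \<epsilon> X \<longrightarrow> (\<exists>!y. opair x y \<epsilon> f))"

definition is_injection :: "'v \<Rightarrow> 'v \<Rightarrow> 'v \<Rightarrow> bool" where
  "is_injection f X Y \<longleftrightarrow> is_function f X Y \<and>
     (\<forall>x x' y. opair x y \<epsilon> f \<and> opair x' y \<epsilon> f \<longrightarrow> x = x')"

definition is_bijection :: "'v \<Rightarrow> 'v \<Rightarrow> 'v \<Rightarrow> bool" where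
  "is_bijection f X Y \<longleftrightarrow> is_injection f X Y \<and> (\<forall>y. y \<epsilon> Y \<longrightarrow> (\<exists>x. opair x y \<epsilon> f))"

definition is_finite :: "'v \<Rightarrow> bool" where
  "is_finite X \<longleftrightarrow> (\<exists>n f. n \<epsilon> omega \<and> is_bijection f n X)"

definition dedekind_infinite :: "'v \<Rightarrow> bool" where
  "dedekind_infinite X \<longleftrightarrow> (\<exists>f. is_injection f omega X)"

abbreviation dedekind_finite :: "'v \<Rightarrow> bool" where
  "dedekind_finite X \<equiv> \<not> dedekind_infinite X"

definition fin :: "'v \<Rightarrow> 'v" where
  "fin A = coll (\<lambda>x. subset x A \<and> is_finite x)"

definition is_partition :: "'v \<Rightarrow> 'v \<Rightarrow> bool" where
  "is_partition P A \<longleftrightarrow>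
     (\<forall>b. b \<epsilon> P \<longrightarrow> (\<exists>x. x \<epsilon> b)) \<and>
     (\<forall>b c. b \<epsilon> P \<and> c \<epsilon> P \<and> b \<noteq> c \<longrightarrow> \<not> (\<exists>x. x \<epsilon> b \<and> x \<epsilon> c)) \<and>
     (\<forall>x. x \<epsilon> A \<longleftrightarrow> (\<exists>b. b \<epsilon> P \<and> x \<epsilon> b))"

definition is_finitary :: "'v \<Rightarrow> bool" where
  "is_finitary P \<longleftrightarrow> (\<forall>b. b \<epsilon> P \<longrightarrow> is_finite b)"

definition finitary_partitions :: "'v \<Rightarrow> 'v" where
  "finitary_partitions A = coll (\<lambda>P. is_partition P A \<and> is_finitary P)"

definition fibre :: "'v \<Rightarrow> 'v \<Rightarrow> 'v" where
  "fibre f z = coll (\<lambda>x. opair x z \<epsilon> f)"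

definition dedekind_finite_to_one :: "'v \<Rightarrow> bool" where
  "dedekind_finite_to_one f \<longleftrightarrow> (\<forall>z. (\<exists>x. opair x z \<epsilon> f) \<longrightarrow> dedekind_finite (fibre f z))"

end

section \<open>Models of ZF\<close>

locale zf_model = set_structure mem for mem :: "'v \<Rightarrow> 'v \<Rightarrow> bool" (infix "\<epsilon>" 50) +
  assumes extensionality: "(\<forall>z. z \<epsilon> x \<longleftrightarrow> z \<epsilon> y) \<Longrightarrow> x = y"
    and foundation: "\<exists>y. y \<epsilon> x \<Longrightarrow> \<exists>y. y \<epsilon> x \<and> \<not> (\<exists>z. z \<epsilon> y \<and> z \<epsilon> x)"
    and pairing: "\<exists>z. \<forall>w. w \<epsilon> z \<longleftrightarrow> w = x \<or> w = y"
    and union: "\<exists>u. \<forall>z. z \<epsilon> u \<longleftrightarrow> (\<exists>y. y \<epsilon> x \<and> z \<epsilon> y)"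
    and power_set: "\<exists>p. \<forall>z. z \<epsilon> p \<longleftrightarrow> subset z x"
    and infinity: "\<exists>I. is_inductive I"
    and separation: "\<exists>y. \<forall>z. z \<epsilon> y \<longleftrightarrow> z \<epsilon> x \<and> sat mem (case_nat z e) \<phi>"
    and replacement:
      "(\<forall>a b b'. a \<epsilon> x \<and> sat mem (case_nat a (case_nat b e)) \<phi>
                      \<and> sat mem (case_nat a (case_nat b' e)) \<phi> \<longrightarrow> b = b')
       \<Longrightarrow> \<exists>y. \<forall>b. b \<epsilon> y \<longleftrightarrow> (\<exists>a. a \<epsilon> x \<and> sat mem (case_nat a (case_nat b e)) \<phi>)"

section \<open>Well-definedness of the comprehensions\<close>

definition definable :: "('v \<Rightarrow> 'v \<Rightarrow> bool) \<Rightarrow> ((nat \<Rightarrow> 'v) \<Rightarrow> bool) \<Rightarrow> bool" where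
  "definable mem P \<longleftrightarrow> (\<exists>\<phi>. \<forall>e. P e \<longleftrightarrow> sat mem e \<phi>)"

lemma definable_mem: "definable mem (\<lambda>e. mem (e i) (e j))"
  unfolding definable_def by (rule exI[of _ "Mem i j"]) simp

lemma definable_eq: "definable mem (\<lambda>e. e i = e j)"
  unfolding definable_def by (rule exI[of _ "Eq i j"]) simp

lemma definable_not: "definable mem P \<Longrightarrow> definable mem (\<lambda>e. \<not> P e)"
  unfolding definable_def by (metis sat.simps(3))

lemma definable_conj:
  "definable mem P \<Longrightarrow> definable mem Q \<Longrightarrow> definable mem (\<lambda>e. P e \<and> Q e)"
  unfolding definable_def by (metis sat.simps(4))

lemma definable_all:
  assumes "definable mem (\<lambda>e. Q (e 0) (\<lambda>n. e (Suc n)))"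
  shows "definable mem (\<lambda>e. \<forall>a. Q a e)"
proof -
  obtain \<phi> where "\<And>e. Q (e 0) (\<lambda>n. e (Suc n)) \<longleftrightarrow> sat mem e \<phi>"
    using assms unfolding definable_def by blast
  from this[of "case_nat _ _"] have "\<And>a e. Q a e \<longleftrightarrow> sat mem (case_nat a e) \<phi>"
    by simp
  then show ?thesis
    unfolding definable_def by (intro exI[of _ "All \<phi>"]) simp
qed

lemma definable_disj:
  assumes "definable mem P" "definable mem Q"
  shows "definable mem (\<lambda>e. P e \<or> Q e)"
proof -
  have "definable mem (\<lambda>e. \<not> (\<not> P e \<and> \<not> Q e))"
    by (intro definable_not definable_conj assms)
  then show ?thesis by simp
qed

lemma definable_imp:
  assumes "definable mem P" "definable mem Q"
  shows "definable mem (\<lambda>e. P e \<longrightarrow> Q e)"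
  unfolding imp_conv_disj by (intro definable_not definable_disj assms)

lemma definable_iff:
  assumes "definable mem P" "definable mem Q"
  shows "definable mem (\<lambda>e. P e \<longleftrightarrow> Q e)"
  unfolding iff_conv_conj_imp by (intro definable_conj definable_imp assms)

lemma definable_ex:
  assumes "definable mem (\<lambda>e. Q (e 0) (\<lambda>n. e (Suc n)))"
  shows "definable mem (\<lambda>e. \<exists>a. Q a e)"
  using definable_not[OF definable_all[of mem "\<lambda>a e. \<not> Q a e", OF definable_not[OF assms]]]
  by simp

lemmas definable_intros = definable_mem definable_eq definable_not definable_conj
  definable_disj definable_imp definable_iff definable_all definable_ex

context zf_model
begin

lemma mem_coll:
  assumes "\<exists>z. \<forall>x. x \<epsilon> z \<longleftrightarrow> P x"
  shows "x \<epsilon> coll P \<longleftrightarrow> P x"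
proof -
  have "\<exists>!z. \<forall>x. x \<epsilon> z \<longleftrightarrow> P x"
    using assms extensionality by (metis (no_types))
  from theI'[OF this] show ?thesis
    unfolding coll_def by blast
qed

lemma definable_separation:
  assumes "definable mem (\<lambda>e. Q (e 0) (\<lambda>n. e (Suc n)))"
  shows "\<exists>y. \<forall>z. z \<epsilon> y \<longleftrightarrow> z \<epsilon> x \<and> Q z e"
proof -
  obtain \<phi> where "\<And>e. Q (e 0) (\<lambda>n. e (Suc n)) \<longleftrightarrow> sat mem e \<phi>"
    using assms unfolding definable_def by blast
  from this[of "case_nat _ _"] have "\<And>a. Q a e \<longleftrightarrow> sat mem (case_nat a e) \<phi>"
    by simp
  then show ?thesis
    using separation[of x e \<phi>] by simp
qed

lemma mem_upair: "x \<epsilon> upair a b \<longleftrightarrow> x = a \<or> x = b"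
  unfolding upair_def by (rule mem_coll) (rule pairing)

lemma eq_upair_iff: "p = upair a b \<longleftrightarrow> (\<forall>x. x \<epsilon> p \<longleftrightarrow> x = a \<or> x = b)"
proof
  assume "p = upair a b"
  then show "\<forall>x. x \<epsilon> p \<longleftrightarrow> x = a \<or> x = b"
    by (simp add: mem_upair)
next
  assume "\<forall>x. x \<epsilon> p \<longleftrightarrow> x = a \<or> x = b"
  then show "p = upair a b"
    by (intro extensionality) (simp add: mem_upair)
qed

lemma eq_opair_iff:
  "p = opair a b \<longleftrightarrow>
     (\<exists>u v. (\<forall>x. x \<epsilon> u \<longleftrightarrow> x = a \<or> x = a) \<and> (\<forall>x. x \<epsilon> v \<longleftrightarrow> x = a \<or> x = b) \<and>
            (\<forall>x. x \<epsilon> p \<longleftrightarrow> x = u \<or> x = v))"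
proof -
  have "p = opair a b \<longleftrightarrow> (\<exists>u v. u = upair a a \<and> v = upair a b \<and> p = upair u v)"
    by (simp add: opair_def)
  then show ?thesis
    by (simp only: eq_upair_iff)
qed

lemma opair_eq_iff: "opair a b = opair c d \<longleftrightarrow> a = c \<and> b = d"
proof
  assume eq: "opair a b = opair c d"
  have up: "a = c \<and> b = d \<or> a = d \<and> b = c" if "upair a b = upair c d" for a b c d
    using that mem_upair by metis
  show "a = c \<and> b = d"
    using up[OF eq[unfolded opair_def]] up by metis
qed simp

lemma mem_omega: "n \<epsilon> omega \<longleftrightarrow> (\<forall>I. is_inductive I \<longrightarrow> n \<epsilon> I)"
  unfolding omega_def
proof (rule mem_coll)
  obtain I where I: "is_inductive I"
    using infinity by blast
  have "\<exists>y. \<forall>z. z \<epsilon> y \<longleftrightarrow> z \<epsilon> I \<and> (\<forall>I. is_inductive I \<longrightarrow> z \<epsilon> I)"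
    by (rule definable_separation[where Q = "\<lambda>z e. \<forall>I. is_inductive I \<longrightarrow> z \<epsilon> I"],
        unfold is_inductive_def) (intro definable_intros)
  then show "\<exists>y. \<forall>z. z \<epsilon> y \<longleftrightarrow> (\<forall>I. is_inductive I \<longrightarrow> z \<epsilon> I)"
    using I by metis
qed

lemma mem_iff_ex: "opair x y \<epsilon> f \<longleftrightarrow> (\<exists>p. p \<epsilon> f \<and> p = opair x y)"
  by blast

lemma definable_is_finite: "definable mem (\<lambda>e. is_finite (e i))"
  unfolding is_finite_def is_bijection_def is_injection_def is_function_def Ex1_def
    mem_iff_ex eq_opair_iff mem_omega is_inductive_def
  by (intro definable_intros)

lemma mem_fin: "x \<epsilon> fin A \<longleftrightarrow> subset x A \<and> is_finite x"
  unfolding fin_def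
proof (rule mem_coll)
  obtain p where p: "\<forall>z. z \<epsilon> p \<longleftrightarrow> subset z A"
    using power_set by blast
  have "\<exists>y. \<forall>z. z \<epsilon> y \<longleftrightarrow> z \<epsilon> p \<and> is_finite z"
    by (rule definable_separation[where Q = "\<lambda>z e. is_finite z"]) (rule definable_is_finite)
  then show "\<exists>z. \<forall>x. x \<epsilon> z \<longleftrightarrow> subset x A \<and> is_finite x"
    using p by simp
qed

lemma mem_finitary_partitions:
  "P \<epsilon> finitary_partitions A \<longleftrightarrow> is_partition P A \<and> is_finitary P"
  unfolding finitary_partitions_def
proof (rule mem_coll)
  obtain p where p: "\<forall>z. z \<epsilon> p \<longleftrightarrow> subset z A"
    using power_set by blast
  obtain q where q: "\<forall>z. z \<epsilon> q \<longleftrightarrow> subset z p"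
    using power_set by blast
  have "definable mem (\<lambda>e. is_partition (e 0) (e (Suc 0)) \<and> is_finitary (e 0))"
    unfolding is_partition_def is_finitary_def
    by (intro definable_intros definable_is_finite)
  from definable_separation[where e = "\<lambda>_. A" and x = q
      and Q = "\<lambda>P e. is_partition P (e 0) \<and> is_finitary P", OF this]
  obtain y where y: "\<And>P. P \<epsilon> y \<longleftrightarrow> P \<epsilon> q \<and> is_partition P A \<and> is_finitary P"
    by blast
  have pq: "P \<epsilon> q" if P: "is_partition P A" for P
  proof -
    have "b \<epsilon> p" if "b \<epsilon> P" for b
    proof -
      have "x \<epsilon> A" if "x \<epsilon> b" for x
        using P \<open>b \<epsilon> P\<close> that unfolding is_partition_def by blast
      then show ?thesis
        using p unfolding subset_def by blast
    qed
    then show ?thesis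
      using q unfolding subset_def by blast
  qed
  show "\<exists>z. \<forall>P. P \<epsilon> z \<longleftrightarrow> is_partition P A \<and> is_finitary P"
    by (rule exI[of _ y]) (use y pq in blast)
qed

lemma mem_fibre: "x \<epsilon> fibre f z \<longleftrightarrow> opair x z \<epsilon> f"
  unfolding fibre_def
proof (rule mem_coll)
  obtain u where u: "\<forall>z. z \<epsilon> u \<longleftrightarrow> (\<exists>y. y \<epsilon> f \<and> z \<epsilon> y)"
    using union by blast
  obtain v where v: "\<forall>z. z \<epsilon> v \<longleftrightarrow> (\<exists>y. y \<epsilon> u \<and> z \<epsilon> y)"
    using union by blast
  have "definable mem (\<lambda>e. opair (e 0) (e (Suc 0)) \<epsilon> e (Suc (Suc 0)))"
    unfolding mem_iff_ex eq_opair_iff by (intro definable_intros)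
  from definable_separation[where e = "case_nat z (\<lambda>_. f)" and x = v
      and Q = "\<lambda>x e. opair x (e 0) \<epsilon> e (Suc 0)", OF this]
  have "\<exists>y. \<forall>x. x \<epsilon> y \<longleftrightarrow> x \<epsilon> v \<and> opair x z \<epsilon> f"
    by simp
  moreover have "opair x z \<epsilon> f \<Longrightarrow> x \<epsilon> v" for x
    using u v by (metis mem_upair opair_def)
  ultimately show "\<exists>y. \<forall>x. x \<epsilon> y \<longleftrightarrow> opair x z \<epsilon> f"
    by auto
qed

end

end

theory Submission
  imports Defs
begin

text \<open>
  Suppose \<open>f\<close> maps \<open>\<B>(A)\<close> to \<open>fin(A)\<close> with Dedekind finite fibres.  Starting from an injection
  \<open>g\<close> of \<open>\<omega>\<close> into \<open>\<B>(A)\<close>, we define by recursion an injection of the class of all ordinals into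
  \<open>\<B>(A)\<close>, which contradicts Replacement.  At an infinite ordinal \<open>\<gamma>\<close> let \<open>X\<^sub>\<xi>\<close> (\<open>\<xi> < \<gamma>\<close>) be the
  partitions found so far.  The nonempty sets among \<open>D\<^sub>\<xi> = f(X\<^sub>\<xi>) - \<Union>\<^bsub>\<eta><\<xi>\<^esub> f(X\<^sub>\<eta>)\<close> are finite and
  pairwise disjoint, and we index them by their order type \<open>\<tau>\<close>.  The set \<open>f(X\<^sub>\<xi>)\<close> meets only finitely
  many of them, say those with index in \<open>S\<^sub>\<xi>\<close>, and \<open>\<xi> \<mapsto> S\<^sub>\<xi>\<close> is finite-to-one because a
  well-orderable Dedekind finite set is finite; in particular \<open>\<tau>\<close> is infinite.  An injection of
  \<open>fin(\<tau>)\<close> into \<open>\<tau>\<close> that is definable from \<open>\<tau>\<close> turns \<open>\<xi> \<mapsto> S\<^sub>\<xi>\<close> into an injection of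
  \<open>\<gamma> \<times> 2\<close> into \<open>\<tau>\<close>, hence yields pairwise disjoint finite sets \<open>E\<^sub>\<xi> \<subseteq> A\<close> with at least two
  elements each.  The partition into those \<open>E\<^sub>\<xi>\<close> that are not blocks of \<open>X\<^sub>\<xi>\<close> and singletons differs
  from every \<open>X\<^sub>\<xi>\<close>.

  No choice is available, so the injection \<open>fin(\<tau>) \<rightarrow> \<tau>\<close> must be uniform in \<open>\<tau>\<close>.  An injection
  \<open>q : fin(\<delta>) \<rightarrow> \<delta>\<close> codes pairs, so it extends to an injection \<open>fin(\<delta> + \<delta>) \<rightarrow> \<delta> + \<delta>\<close>; iterating
  this from \<open>\<delta> = \<omega>\<close> and taking unions at limits reaches, for each infinite \<open>\<tau>\<close>, a \<open>\<delta>\<close> with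
  \<open>\<delta> \<le> \<tau> < \<delta> + \<delta>\<close>, and \<open>fin(\<delta> + \<delta>)\<close> already injects into \<open>\<delta>\<close>.
\<close>

section \<open>Definability with parameters\<close>

primrec rename :: "(nat \<Rightarrow> nat) \<Rightarrow> fm \<Rightarrow> fm" where
  "rename s (Mem i j) = Mem (s i) (s j)"
| "rename s (Eq i j) = Eq (s i) (s j)"
| "rename s (Neg p) = Neg (rename s p)"
| "rename s (Conj p q) = Conj (rename s p) (rename s q)"
| "rename s (All p) = All (rename (case_nat 0 (\<lambda>n. Suc (s n))) p)"

lemma sat_rename: "sat mem e (rename s p) \<longleftrightarrow> sat mem (\<lambda>n. e (s n)) p"
proof (induction p arbitrary: e s)
  case (All p)
  have "(\<lambda>n. case_nat a e (case_nat 0 (\<lambda>n. Suc (s n)) n)) = case_nat a (\<lambda>n. e (s n))" for a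
    by (auto split: nat.split)
  then show ?case
    using All by simp
qed auto

context set_structure
begin

text \<open>Unlike \<open>definable\<close>, \<open>pdef\<close> allows parameters: a variable of the formula stands for an entry of the
  assignment (\<open>Inl\<close>) or for a fixed set (\<open>Inr\<close>).\<close>

definition pdef :: "((nat \<Rightarrow> 'v) \<Rightarrow> bool) \<Rightarrow> bool" where
  "pdef P \<longleftrightarrow> (\<exists>\<phi> v. \<forall>e. P e \<longleftrightarrow> sat mem (\<lambda>n. case_sum e id (v n)) \<phi>)"

text \<open>Formulas have no function symbols, so a term is handled through its graph, with the
  value in variable 0. This lets set operations occur inside formulas.\<close>

definition tm :: "((nat \<Rightarrow> 'v) \<Rightarrow> 'v) \<Rightarrow> bool" where
  "tm t \<longleftrightarrow> pdef (\<lambda>e. e 0 = t (\<lambda>n. e (Suc n)))"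

lemma pdef_rename:
  assumes "pdef P"
  shows "pdef (\<lambda>e. P (\<lambda>n. e (s n)))"
proof -
  obtain \<phi> v where "\<And>e. P e \<longleftrightarrow> sat mem (\<lambda>n. case_sum e id (v n)) \<phi>"
    using assms unfolding pdef_def by blast
  moreover have "case_sum (\<lambda>n. e (s n)) id x = case_sum e id (map_sum s id x)" for e :: "nat \<Rightarrow> 'v" and x
    by (cases x) auto
  ultimately have "P (\<lambda>n. e (s n)) \<longleftrightarrow> sat mem (\<lambda>n. case_sum e id (map_sum s id (v n))) \<phi>" for e
    by simp
  then show ?thesis
    unfolding pdef_def by (intro exI[of _ \<phi>] exI[of _ "\<lambda>n. map_sum s id (v n)"]) blast
qed

lemma pdef_not:
  assumes "pdef P"
  shows "pdef (\<lambda>e. \<not> P e)"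
proof -
  obtain \<phi> v where "\<And>e. P e \<longleftrightarrow> sat mem (\<lambda>n. case_sum e id (v n)) \<phi>"
    using assms unfolding pdef_def by blast
  then show ?thesis
    unfolding pdef_def by (intro exI[of _ "Neg \<phi>"] exI[of _ v]) simp
qed

lemma pdef_conj:
  assumes "pdef P" "pdef Q"
  shows "pdef (\<lambda>e. P e \<and> Q e)"
proof -
  obtain \<phi> v where P: "\<And>e. P e \<longleftrightarrow> sat mem (\<lambda>n. case_sum e id (v n)) \<phi>"
    using assms unfolding pdef_def by blast
  obtain \<psi> w where Q: "\<And>e. Q e \<longleftrightarrow> sat mem (\<lambda>n. case_sum e id (w n)) \<psi>"
    using assms unfolding pdef_def by blast
  \<comment> \<open>Each formula comes with its own parameter list; interleaving on even and odd
    variables keeps the two lists apart.\<close>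
  define u where "u n = (if even n then v (n div 2) else w (n div 2))" for n
  have "P e \<and> Q e \<longleftrightarrow> sat mem (\<lambda>n. case_sum e id (u n))
      (Conj (rename (\<lambda>n. 2 * n) \<phi>) (rename (\<lambda>n. 2 * n + 1) \<psi>))" for e
    by (simp add: sat_rename P Q u_def)
  then show ?thesis
    unfolding pdef_def by blast
qed

text \<open>Separation, Replacement and \<open>All\<close> expect a distinguished variable at index
  0. Every occurrence of entry 0 is redirected to that index, and the remaining entries and
  parameters are shifted past it.\<close>

lemma pdef_bind:
  assumes "pdef P"
  shows "\<exists>\<phi> v. \<forall>a e. P (case_nat a e) \<longleftrightarrow> sat mem (case_nat a (\<lambda>n. case_sum e id (v n))) \<phi>"
proof -
  obtain \<phi> v where P: "\<And>e. P e \<longleftrightarrow> sat mem (\<lambda>n. case_sum e id (v n)) \<phi>"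
    using assms unfolding pdef_def by blast
  define w where "w n = (case v n of Inl i \<Rightarrow> Inl (i - 1) | Inr c \<Rightarrow> Inr c)" for n
  define s where "s n = (if v n = Inl 0 then 0 else Suc n)" for n
  have "(\<lambda>n. case_sum (case_nat a e) id (v n)) = (\<lambda>n. case_nat a (\<lambda>n. case_sum e id (w n)) (s n))" for a e
    by (auto simp: w_def s_def fun_eq_iff split: sum.split nat.split)
  then have "P (case_nat a e) \<longleftrightarrow> sat mem (case_nat a (\<lambda>n. case_sum e id (w n))) (rename s \<phi>)" for a e
    by (simp add: P sat_rename)
  then show ?thesis
    by blast
qed

lemma pdef_all:
  assumes "pdef (\<lambda>e. Q (e 0) (\<lambda>n. e (Suc n)))"
  shows "pdef (\<lambda>e. \<forall>a. Q a e)"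
proof -
  obtain \<phi> v where "\<And>a e. Q a e \<longleftrightarrow> sat mem (case_nat a (\<lambda>n. case_sum e id (v n))) \<phi>"
    using pdef_bind[OF assms] by auto
  then show ?thesis
    unfolding pdef_def by (intro exI[of _ "All \<phi>"] exI[of _ v]) simp
qed

lemma pdef_disj: "pdef P \<Longrightarrow> pdef Q \<Longrightarrow> pdef (\<lambda>e. P e \<or> Q e)"
  using pdef_not[OF pdef_conj[OF pdef_not pdef_not], of P Q] by simp

lemma pdef_imp: "pdef P \<Longrightarrow> pdef Q \<Longrightarrow> pdef (\<lambda>e. P e \<longrightarrow> Q e)"
  unfolding imp_conv_disj by (intro pdef_disj pdef_not)

lemma pdef_iff: "pdef P \<Longrightarrow> pdef Q \<Longrightarrow> pdef (\<lambda>e. P e \<longleftrightarrow> Q e)"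
  unfolding iff_conv_conj_imp by (intro pdef_conj pdef_imp)

lemma pdef_ex:
  assumes "pdef (\<lambda>e. Q (e 0) (\<lambda>n. e (Suc n)))"
  shows "pdef (\<lambda>e. \<exists>a. Q a e)"
  using pdef_not[OF pdef_all[of "\<lambda>a e. \<not> Q a e", OF pdef_not[OF assms]]] by simp

lemma pdef_const: "pdef (\<lambda>e. b)"
proof -
  have "pdef (\<lambda>e. True)"
    unfolding pdef_def by (intro exI[of _ "Eq 0 0"]) simp
  moreover from pdef_not[OF this] have "pdef (\<lambda>e. False)" by simp
  ultimately show ?thesis by (cases b) auto
qed

section \<open>Substitution of terms into formulas and terms\<close>

lemma pdef_subst:
  assumes "tm t" "pdef (\<lambda>e. Q (e 0) (\<lambda>n. e (Suc n)))"
  shows "pdef (\<lambda>e. Q (t e) e)"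
proof -
  have "pdef (\<lambda>e. \<exists>a. a = t e \<and> Q a e)"
    by (rule pdef_ex, rule pdef_conj) (use assms in \<open>auto simp: tm_def\<close>)
  then show ?thesis by simp
qed

lemma tm_rename: "tm t \<Longrightarrow> tm (\<lambda>e. t (\<lambda>n. e (s n)))"
  unfolding tm_def using pdef_rename[where s = "case_nat 0 (\<lambda>n. Suc (s n))"] by fastforce

lemma tm_var: "tm (\<lambda>e. e i)"
  unfolding tm_def pdef_def
  by (intro exI[of _ "Eq 0 1"] exI[of _ "case_nat (Inl 0) (\<lambda>_. Inl (Suc i))"]) simp

lemma tm_const: "tm (\<lambda>e. c)"
  unfolding tm_def pdef_def
  by (intro exI[of _ "Eq 0 1"] exI[of _ "case_nat (Inl 0) (\<lambda>_. Inr c)"]) simp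

text \<open>Simultaneous substitution, by induction on the formula. At a quantifier the bound
  variable becomes a new first term and the given terms are shifted past it.\<close>

lemma pdef_sat_terms:
  assumes "\<And>n. tm (t n)"
  shows "pdef (\<lambda>e. sat mem (\<lambda>n. t n e) \<phi>)"
  using assms
proof (induction \<phi> arbitrary: t)
  case (Mem i j)
  have b: "pdef (\<lambda>e. e 1 \<epsilon> e 0)"
    unfolding pdef_def by (intro exI[of _ "Mem 1 0"] exI[of _ Inl]) simp
  \<comment> \<open>Terms are put in one at a time: here \<open>t i\<close>, with variable 0 still
    standing for the right-hand side of the membership.\<close>
  have "pdef (\<lambda>e. t i (\<lambda>n. e (Suc n)) \<epsilon> e 0)"
    by (rule pdef_subst[OF tm_rename[OF Mem]]) (use pdef_rename[OF b, of "\<lambda>n. 1 - n"] in simp)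
  then have "pdef (\<lambda>e. t i e \<epsilon> t j e)"
    by (rule pdef_subst[OF Mem])
  then show ?case by simp
next
  case (Eq i j)
  have "pdef (\<lambda>e. t i e = t j e)"
    using pdef_subst[OF Eq[of i], of "\<lambda>a e. a = t j e"] Eq[of j] by (simp add: tm_def)
  then show ?case by simp
next
  case (Neg \<phi>)
  then show ?case by (simp add: pdef_not)
next
  case (Conj \<phi> \<psi>)
  then show ?case by (simp add: pdef_conj)
next
  case (All \<phi>)
  have "tm (case_nat (\<lambda>e. e 0) (\<lambda>n e. t n (\<lambda>n. e (Suc n))) n)" for n
    using tm_var tm_rename[OF All.prems] by (cases n) auto
  note 1 = All.IH[of "\<lambda>n. case_nat (\<lambda>e. e 0) (\<lambda>n e. t n (\<lambda>n. e (Suc n))) n", OF this]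
  have "(\<lambda>n. case_nat (\<lambda>e. e 0) (\<lambda>n e. t n (\<lambda>n. e (Suc n))) n e)
      = case_nat (e 0) (\<lambda>n. t n (\<lambda>n. e (Suc n)))" for e
    by (auto split: nat.split)
  with 1 have "pdef (\<lambda>e. sat mem (case_nat (e 0) (\<lambda>n. t n (\<lambda>n. e (Suc n)))) \<phi>)"
    by simp
  from pdef_all[of "\<lambda>a e. sat mem (case_nat a (\<lambda>n. t n e)) \<phi>", OF this] show ?case
    by simp
qed

lemma pdef_terms:
  assumes "pdef P" "\<And>n. tm (t n)"
  shows "pdef (\<lambda>e. P (\<lambda>n. t n e))"
proof -
  obtain \<phi> v where P: "\<And>e. P e \<longleftrightarrow> sat mem (\<lambda>n. case_sum e id (v n)) \<phi>"
    using assms unfolding pdef_def by blast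
  have "tm (case_sum t (\<lambda>c _. c) x)" for x
    using assms(2) tm_const by (cases x) auto
  note 1 = pdef_sat_terms[of "\<lambda>n. case_sum t (\<lambda>c _. c) (v n)", OF this, of \<phi>]
  have "case_sum t (\<lambda>c _. c) x e = case_sum (\<lambda>n. t n e) id x" for x e
    by (cases x) auto
  with 1 show ?thesis
    by (simp add: P)
qed

lemma pdef1: "pdef (\<lambda>e. R (e 0)) \<Longrightarrow> tm s \<Longrightarrow> pdef (\<lambda>e. R (s e))"
  using pdef_terms[of "\<lambda>e. R (e 0)" "\<lambda>_. s"] by simp

lemma pdef2: "pdef (\<lambda>e. R (e 0) (e 1)) \<Longrightarrow> tm s \<Longrightarrow> tm t \<Longrightarrow> pdef (\<lambda>e. R (s e) (t e))"
  using pdef_terms[of "\<lambda>e. R (e 0) (e 1)" "case_nat s (\<lambda>_. t)"] by (simp split: nat.split)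

lemma pdef3:
  "pdef (\<lambda>e. R (e 0) (e 1) (e 2)) \<Longrightarrow> tm s \<Longrightarrow> tm t \<Longrightarrow> tm u \<Longrightarrow> pdef (\<lambda>e. R (s e) (t e) (u e))"
  using pdef_terms[of "\<lambda>e. R (e 0) (e 1) (e 2)" "case_nat s (case_nat t (\<lambda>_. u))"]
  by (simp add: eval_nat_numeral split: nat.split)

lemma tm_terms:
  assumes "tm P" "\<And>n. tm (t n)"
  shows "tm (\<lambda>e. P (\<lambda>n. t n e))"
proof -
  have "tm (case n of 0 \<Rightarrow> \<lambda>e. e 0 | Suc m \<Rightarrow> \<lambda>e. t m (\<lambda>n. e (Suc n)))" for n
    using tm_var tm_rename[OF assms(2)] by (cases n) auto
  from pdef_terms[OF assms(1)[unfolded tm_def], of "case_nat (\<lambda>e. e 0) (\<lambda>m e. t m (\<lambda>n. e (Suc n)))", OF this]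
  show ?thesis
    by (simp add: tm_def)
qed

lemma tm1: "tm (\<lambda>e. F (e 0)) \<Longrightarrow> tm s \<Longrightarrow> tm (\<lambda>e. F (s e))"
  using tm_terms[of "\<lambda>e. F (e 0)" "\<lambda>_. s"] by simp

lemma tm2: "tm (\<lambda>e. F (e 0) (e 1)) \<Longrightarrow> tm s \<Longrightarrow> tm t \<Longrightarrow> tm (\<lambda>e. F (s e) (t e))"
  using tm_terms[of "\<lambda>e. F (e 0) (e 1)" "case_nat s (\<lambda>_. t)"] by (simp split: nat.split)

lemma tm3:
  "tm (\<lambda>e. F (e 0) (e 1) (e 2)) \<Longrightarrow> tm s \<Longrightarrow> tm t \<Longrightarrow> tm u \<Longrightarrow> tm (\<lambda>e. F (s e) (t e) (u e))"
  using tm_terms[of "\<lambda>e. F (e 0) (e 1) (e 2)" "case_nat s (case_nat t (\<lambda>_. u))"]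
  by (simp add: eval_nat_numeral split: nat.split)

lemma tm4:
  "tm (\<lambda>e. F (e 0) (e 1) (e 2) (e 3)) \<Longrightarrow> tm s \<Longrightarrow> tm t \<Longrightarrow> tm u \<Longrightarrow> tm w \<Longrightarrow>
    tm (\<lambda>e. F (s e) (t e) (u e) (w e))"
  using tm_terms[of "\<lambda>e. F (e 0) (e 1) (e 2) (e 3)" "case_nat s (case_nat t (case_nat u (\<lambda>_. w)))"]
  by (simp add: eval_nat_numeral split: nat.split)

lemma pdef_mem: "tm s \<Longrightarrow> tm t \<Longrightarrow> pdef (\<lambda>e. s e \<epsilon> t e)"
  using pdef_sat_terms[of "case_nat s (\<lambda>_. t)" "Mem 0 1"] by (simp split: nat.split)

lemma pdef_eq: "tm s \<Longrightarrow> tm t \<Longrightarrow> pdef (\<lambda>e. s e = t e)"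
  using pdef_sat_terms[of "case_nat s (\<lambda>_. t)" "Eq 0 1"] by (simp split: nat.split)

text \<open>For a proper class the description is always the same object, whatever \<open>P\<close>
  is. Taking that object as a parameter makes the graph of \<open>coll\<close> definable without a
  proof that the comprehension exists.\<close>

lemma coll_undefined:
  assumes "\<not> (\<exists>z. \<forall>x. x \<epsilon> z \<longleftrightarrow> P x)"
  shows "coll P = (THE z. False)"
proof -
  have "(\<lambda>z. \<forall>x. x \<epsilon> z \<longleftrightarrow> P x) = (\<lambda>z. False)"
    using assms by (intro ext) blast
  then show ?thesis
    unfolding coll_def by simp
qed

end

section \<open>Comprehension, Separation and Replacement for definable classes\<close>

context zf_model
begin

lemma eq_coll_iff:
  "w = coll P \<longleftrightarrow> (\<forall>x. x \<epsilon> w \<longleftrightarrow> P x) \<or> \<not> (\<exists>z. \<forall>x. x \<epsilon> z \<longleftrightarrow> P x) \<and> w = (THE z. False)"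
  using mem_coll[of P] extensionality[of w "coll P"] coll_undefined[of P] by metis

lemma tm_coll:
  assumes "pdef (\<lambda>e. Q (e 0) (\<lambda>n. e (Suc n)))"
  shows "tm (\<lambda>e. coll (\<lambda>z. Q z e))"
proof -
  have Q: "pdef (\<lambda>e. Q (e 0) (\<lambda>n. e (Suc (Suc (Suc n)))))"
    using pdef_rename[OF assms, of "case_nat 0 (\<lambda>n. Suc (Suc (Suc n)))"] by simp
  have Q': "pdef (\<lambda>e. Q (e 0) (\<lambda>n. e (Suc (Suc n))))"
    using pdef_rename[OF assms, of "case_nat 0 (\<lambda>n. Suc (Suc n))"] by simp
  show ?thesis
    unfolding tm_def eq_coll_iff
    by (intro pdef_disj pdef_conj pdef_not pdef_all pdef_ex pdef_iff pdef_mem pdef_eq tm_var tm_const Q Q')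
qed

lemma separation_pdef:
  assumes "pdef (\<lambda>e. Q (e 0))"
  shows "\<exists>y. \<forall>z. z \<epsilon> y \<longleftrightarrow> z \<epsilon> x \<and> Q z"
proof -
  obtain \<phi> v where *: "\<forall>a e. Q (case_nat a e 0) \<longleftrightarrow>
      sat mem (case_nat a (\<lambda>n. case_sum e id (v n))) \<phi>"
    using pdef_bind[OF assms] by blast
  \<comment> \<open>\<open>Q\<close> depends on entry 0 only, so the remaining free variables are
    filled with the arbitrary set \<open>x\<close>.\<close>
  then have "sat mem (case_nat a (\<lambda>n. case_sum (\<lambda>_. x) id (v n))) \<phi> \<longleftrightarrow> Q a" for a
    by simp
  then show ?thesis
    using separation[of x "\<lambda>n. case_sum (\<lambda>_. x) id (v n)" \<phi>] by simp
qed

lemma replacement_tm: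
  assumes "tm (\<lambda>e. F (e 0))"
  shows "\<exists>y. \<forall>z. z \<epsilon> y \<longleftrightarrow> (\<exists>x. x \<epsilon> X \<and> z = F x)"
proof -
  have "pdef (\<lambda>e. e 1 = F (e 0))"
    by (intro pdef_eq tm_var assms)
  from pdef_bind[OF this] obtain \<phi> v where
    *: "\<forall>a e. case_nat a e 1 = F (case_nat a e 0) \<longleftrightarrow>
      sat mem (case_nat a (\<lambda>n. case_sum e id (v n))) \<phi>"
    by blast
  \<comment> \<open>The schema wants the argument at index 0, the value at index 1 and parameters
    from index 2 on. Since \<open>*\<close> is used with the constant assignment \<open>b\<close>,
    the renaming \<open>t\<close> sends every \<open>Inl\<close> variable to index 1 and every
    \<open>Inr\<close> variable to its slot in \<open>c\<close>.\<close>
  define c where "c = (\<lambda>n. case v n of Inl _ \<Rightarrow> X | Inr c \<Rightarrow> c)"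
  have "b = F a \<longleftrightarrow> sat mem (case_nat a (\<lambda>n. case_sum (\<lambda>_. b) id (v n))) \<phi>" for a b
    using *[rule_format, of a "\<lambda>_. b"] by simp
  moreover define t where "t n = (case n of 0 \<Rightarrow> 0 | Suc n \<Rightarrow> case v n of Inl _ \<Rightarrow> 1 | Inr _ \<Rightarrow> Suc (Suc n))" for n
  have "case_nat a (\<lambda>n. case_sum (\<lambda>_. b) id (v n)) = (\<lambda>n. case_nat a (case_nat b c) (t n))" for a b
    by (auto simp: fun_eq_iff t_def c_def split: nat.split sum.split)
  ultimately have eq: "b = F a \<longleftrightarrow> sat mem (case_nat a (case_nat b c)) (rename t \<phi>)" for a b
    by (simp add: sat_rename)
  show ?thesis
    unfolding eq by (rule replacement) (simp flip: eq)
qed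

end

named_theorems defn

context zf_model
begin

section \<open>Set theory inside the model\<close>

text \<open>\<open>defn\<close> collects closure rules for formulas and terms. New constants add
  their own, so definability is checked by following the syntax.\<close>

lemmas [defn] = pdef_mem pdef_eq pdef_not pdef_conj pdef_disj pdef_imp pdef_iff pdef_all pdef_ex
  tm_var tm_const tm_coll

lemma upair_tm [defn]: "tm s \<Longrightarrow> tm t \<Longrightarrow> tm (\<lambda>e. upair (s e) (t e))"
  by (rule tm2[where F = upair]) (simp only: upair_def, intro defn)

lemma opair_tm [defn]: "tm s \<Longrightarrow> tm t \<Longrightarrow> tm (\<lambda>e. opair (s e) (t e))"
  by (rule tm2[where F = opair]) (simp only: opair_def, intro defn)

lemma subset_pdef [defn]: "tm s \<Longrightarrow> tm t \<Longrightarrow> pdef (\<lambda>e. subset (s e) (t e))"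
  by (rule pdef2[where R = subset]) (simp only: subset_def, intro defn)

abbreviation img :: "'v \<Rightarrow> ('v \<Rightarrow> 'v) \<Rightarrow> 'v" where
  "img X F \<equiv> coll (\<lambda>z. \<exists>x. x \<epsilon> X \<and> z = F x)"

abbreviation lam :: "'v \<Rightarrow> ('v \<Rightarrow> 'v) \<Rightarrow> 'v" where
  "lam X F \<equiv> coll (\<lambda>p. \<exists>x. x \<epsilon> X \<and> p = opair x (F x))"

definition sUn :: "'v \<Rightarrow> 'v" where "sUn x = coll (\<lambda>z. \<exists>y. y \<epsilon> x \<and> z \<epsilon> y)"
definition cup :: "'v \<Rightarrow> 'v \<Rightarrow> 'v" where "cup x y = coll (\<lambda>z. z \<epsilon> x \<or> z \<epsilon> y)"
definition ins :: "'v \<Rightarrow> 'v \<Rightarrow> 'v" where "ins a x = coll (\<lambda>z. z = a \<or> z \<epsilon> x)"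
definition pow :: "'v \<Rightarrow> 'v" where "pow x = coll (\<lambda>z. subset z x)"
definition emp :: 'v where "emp = coll (\<lambda>z. False)"

text \<open>The union of all values at \<open>x\<close>, which is the value at \<open>x\<close> if that is unique.\<close>

definition app :: "'v \<Rightarrow> 'v \<Rightarrow> 'v" where
  "app h x = coll (\<lambda>z. \<exists>y. opair x y \<epsilon> h \<and> z \<epsilon> y)"

text \<open>Membership lemmas for \<open>coll\<close> match its argument literally, so the simplifier must not rewrite it.\<close>

lemma coll_weak_cong [cong]: "coll P = coll P"
  by (rule refl)

lemma sUn_tm [defn]: "tm s \<Longrightarrow> tm (\<lambda>e. sUn (s e))"
  by (rule tm1[where F = sUn]) (simp only: sUn_def, intro defn)
lemma cup_tm [defn]: "tm s \<Longrightarrow> tm t \<Longrightarrow> tm (\<lambda>e. cup (s e) (t e))"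
  by (rule tm2[where F = cup]) (simp only: cup_def, intro defn)
lemma ins_tm [defn]: "tm s \<Longrightarrow> tm t \<Longrightarrow> tm (\<lambda>e. ins (s e) (t e))"
  by (rule tm2[where F = ins]) (simp only: ins_def, intro defn)
lemma pow_tm [defn]: "tm s \<Longrightarrow> tm (\<lambda>e. pow (s e))"
  by (rule tm1[where F = pow]) (simp only: pow_def, intro defn)
lemma app_tm [defn]: "tm s \<Longrightarrow> tm t \<Longrightarrow> tm (\<lambda>e. app (s e) (t e))"
  by (rule tm2[where F = app]) (simp only: app_def, intro defn)

lemma extI: "(\<And>z. z \<epsilon> x \<longleftrightarrow> z \<epsilon> y) \<Longrightarrow> x = y"
  using extensionality by blast

lemma mem_sUn: "z \<epsilon> sUn x \<longleftrightarrow> (\<exists>y. y \<epsilon> x \<and> z \<epsilon> y)"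
  unfolding sUn_def by (rule mem_coll) (rule union)

lemma mem_cup: "z \<epsilon> cup x y \<longleftrightarrow> z \<epsilon> x \<or> z \<epsilon> y"
  unfolding cup_def
proof (rule mem_coll)
  show "\<exists>w. \<forall>z. z \<epsilon> w \<longleftrightarrow> z \<epsilon> x \<or> z \<epsilon> y"
    by (rule exI[of _ "sUn (upair x y)"]) (auto simp: mem_sUn mem_upair)
qed

lemma mem_ins: "z \<epsilon> ins a x \<longleftrightarrow> z = a \<or> z \<epsilon> x"
  unfolding ins_def
proof (rule mem_coll)
  show "\<exists>w. \<forall>z. z \<epsilon> w \<longleftrightarrow> z = a \<or> z \<epsilon> x"
    by (rule exI[of _ "cup (upair a a) x"]) (auto simp: mem_cup mem_upair)
qed

lemma mem_pow: "z \<epsilon> pow x \<longleftrightarrow> subset z x"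
  unfolding pow_def by (rule mem_coll) (rule power_set)

lemma mem_sep:
  assumes "pdef (\<lambda>e. Q (e 0))"
  shows "z \<epsilon> coll (\<lambda>z. z \<epsilon> x \<and> Q z) \<longleftrightarrow> z \<epsilon> x \<and> Q z"
  by (rule mem_coll) (rule separation_pdef[OF assms])

text \<open>Any bounding set will do, so that a comprehension need not be written as a separation.\<close>

lemma mem_bounded:
  assumes "pdef (\<lambda>e. Q (e 0))" "\<And>z. Q z \<Longrightarrow> z \<epsilon> x"
  shows "z \<epsilon> coll Q \<longleftrightarrow> Q z"
  by (rule mem_coll) (use separation_pdef[OF assms(1), of x] assms(2) in blast)

lemma mem_emp: "\<not> z \<epsilon> emp"
  using mem_coll[of "\<lambda>_. False"] separation_pdef[OF pdef_const, of _ False] unfolding emp_def by auto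

lemma mem_img:
  assumes "tm (\<lambda>e. F (e 0))"
  shows "z \<epsilon> img X F \<longleftrightarrow> (\<exists>x. x \<epsilon> X \<and> z = F x)"
  by (rule mem_coll) (rule replacement_tm[OF assms])

lemma mem_UN:
  assumes "tm (\<lambda>e. F (e 0))"
  shows "z \<epsilon> sUn (img X F) \<longleftrightarrow> (\<exists>x. x \<epsilon> X \<and> z \<epsilon> F x)"
  by (auto simp: mem_sUn mem_img[OF assms])

lemma mem_lam:
  assumes "tm (\<lambda>e. F (e 0))"
  shows "z \<epsilon> lam X F \<longleftrightarrow> (\<exists>x. x \<epsilon> X \<and> z = opair x (F x))"
  by (rule mem_img) (intro defn assms)

lemma app_eqI:
  assumes "opair x y \<epsilon> h" "\<And>z. opair x z \<epsilon> h \<Longrightarrow> z = y"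
  shows "app h x = y"
proof -
  have "\<forall>z. z \<epsilon> y \<longleftrightarrow> (\<exists>w. opair x w \<epsilon> h \<and> z \<epsilon> w)"
    using assms by blast
  then have "z \<epsilon> app h x \<longleftrightarrow> z \<epsilon> y" for z
    unfolding app_def using mem_coll[of "\<lambda>z. \<exists>w. opair x w \<epsilon> h \<and> z \<epsilon> w" z] by blast
  then show ?thesis by (rule extI)
qed

lemma app_lam: "tm (\<lambda>e. F (e 0)) \<Longrightarrow> x \<epsilon> X \<Longrightarrow> app (lam X F) x = F x"
  by (rule app_eqI) (auto simp: mem_lam opair_eq_iff)

lemma lam_function:
  assumes "tm (\<lambda>e. F (e 0))" "\<And>x. x \<epsilon> X \<Longrightarrow> F x \<epsilon> Y"
  shows "is_function (lam X F) X Y"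
  unfolding is_function_def using assms by (auto simp: mem_lam opair_eq_iff)

lemma lam_injection:
  assumes "tm (\<lambda>e. F (e 0))" "\<And>x. x \<epsilon> X \<Longrightarrow> F x \<epsilon> Y"
    "\<And>x y. x \<epsilon> X \<Longrightarrow> y \<epsilon> X \<Longrightarrow> F x = F y \<Longrightarrow> x = y"
  shows "is_injection (lam X F) X Y"
  unfolding is_injection_def using assms lam_function[OF assms(1,2)] by (auto simp: mem_lam opair_eq_iff)

lemma function_app:
  assumes "is_function f X Y" "x \<epsilon> X"
  shows "opair x (app f x) \<epsilon> f" "app f x \<epsilon> Y"
proof -
  obtain y where y: "opair x y \<epsilon> f" "\<And>z. opair x z \<epsilon> f \<Longrightarrow> z = y"
    using assms unfolding is_function_def by blast
  then have "app f x = y" by (rule app_eqI)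
  with y(1) show "opair x (app f x) \<epsilon> f" by simp
  then show "app f x \<epsilon> Y"
    using assms unfolding is_function_def by (metis opair_eq_iff)
qed

lemma function_pair:
  assumes "is_function f X Y"
  shows "opair x y \<epsilon> f \<longleftrightarrow> x \<epsilon> X \<and> y = app f x"
  using assms function_app[OF assms] unfolding is_function_def by (metis opair_eq_iff)

lemma injection_app:
  assumes "is_injection f X Y"
  shows "x \<epsilon> X \<Longrightarrow> app f x \<epsilon> Y"
    "x \<epsilon> X \<Longrightarrow> y \<epsilon> X \<Longrightarrow> app f x = app f y \<Longrightarrow> x = y"
proof -
  have f: "is_function f X Y" using assms unfolding is_injection_def by blast
  show "x \<epsilon> X \<Longrightarrow> app f x \<epsilon> Y" using function_app[OF f] by blast
  show "x \<epsilon> X \<Longrightarrow> y \<epsilon> X \<Longrightarrow> app f x = app f y \<Longrightarrow> x = y"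
    using assms function_app[OF f] unfolding is_injection_def by metis
qed

lemma function_pdef [defn]:
  "tm s \<Longrightarrow> tm t \<Longrightarrow> tm u \<Longrightarrow> pdef (\<lambda>e. is_function (s e) (t e) (u e))"
  by (rule pdef3[where R = is_function]) (simp only: is_function_def Ex1_def, intro defn)

lemma injection_pdef [defn]:
  "tm s \<Longrightarrow> tm t \<Longrightarrow> tm u \<Longrightarrow> pdef (\<lambda>e. is_injection (s e) (t e) (u e))"
  by (rule pdef3[where R = is_injection]) (simp only: is_injection_def, intro defn)

lemma bijection_pdef [defn]:
  "tm s \<Longrightarrow> tm t \<Longrightarrow> tm u \<Longrightarrow> pdef (\<lambda>e. is_bijection (s e) (t e) (u e))"
  by (rule pdef3[where R = is_bijection]) (simp only: is_bijection_def, intro defn)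

lemma finite_pdef [defn]: "tm s \<Longrightarrow> pdef (\<lambda>e. is_finite (s e))"
  by (rule pdef1[where R = is_finite]) (simp only: is_finite_def, intro defn)

lemma dedekind_infinite_pdef [defn]: "tm s \<Longrightarrow> pdef (\<lambda>e. dedekind_infinite (s e))"
  by (rule pdef1[where R = dedekind_infinite]) (simp only: dedekind_infinite_def, intro defn)

lemma fin_tm [defn]: "tm s \<Longrightarrow> tm (\<lambda>e. fin (s e))"
  by (rule tm1[where F = fin]) (simp only: fin_def, intro defn)

lemma no_self: "\<not> x \<epsilon> x"
  using foundation[of "upair x x"] by (auto simp: mem_upair)

lemma no_cycle: "x \<epsilon> y \<Longrightarrow> \<not> y \<epsilon> x"
  using foundation[of "upair x y"] by (auto simp: mem_upair)

section \<open>Ordinals\<close>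

definition trans_set :: "'v \<Rightarrow> bool" where "trans_set a \<longleftrightarrow> (\<forall>b. b \<epsilon> a \<longrightarrow> subset b a)"
text \<open>Under Foundation, transitive sets of transitive sets are the von Neumann ordinals,
  well-ordered by membership.\<close>

definition Ord :: "'v \<Rightarrow> bool" where "Ord a \<longleftrightarrow> trans_set a \<and> (\<forall>b. b \<epsilon> a \<longrightarrow> trans_set b)"
definition succ :: "'v \<Rightarrow> 'v" where "succ a = ins a a"

lemma Ord_pdef [defn]: "tm s \<Longrightarrow> pdef (\<lambda>e. Ord (s e))"
  by (rule pdef1[where R = Ord]) (simp only: Ord_def trans_set_def, intro defn)

lemma succ_tm [defn]: "tm s \<Longrightarrow> tm (\<lambda>e. succ (s e))"
  by (rule tm1[where F = succ]) (simp only: succ_def, intro defn)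

lemma mem_succ: "z \<epsilon> succ a \<longleftrightarrow> z = a \<or> z \<epsilon> a"
  by (simp add: succ_def mem_ins)

lemma Ord_mem: "Ord a \<Longrightarrow> b \<epsilon> a \<Longrightarrow> Ord b"
  unfolding Ord_def trans_set_def subset_def by blast

lemma Ord_trans: "Ord a \<Longrightarrow> b \<epsilon> a \<Longrightarrow> c \<epsilon> b \<Longrightarrow> c \<epsilon> a"
  unfolding Ord_def trans_set_def subset_def by blast

lemma OrdI: "(\<And>b c. b \<epsilon> a \<Longrightarrow> c \<epsilon> b \<Longrightarrow> c \<epsilon> a) \<Longrightarrow> (\<And>b. b \<epsilon> a \<Longrightarrow> Ord b) \<Longrightarrow> Ord a"
  unfolding Ord_def trans_set_def subset_def by blast

lemma Ord_succ: "Ord a \<Longrightarrow> Ord (succ a)"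
  by (rule OrdI) (auto simp: mem_succ intro: Ord_trans Ord_mem)

lemma Ord_emp: "Ord emp"
  by (rule OrdI) (auto simp: mem_emp)

lemma Ord_least:
  assumes "pdef (\<lambda>e. Q (e 0))" "Ord a" "Q a"
  shows "\<exists>b. Ord b \<and> Q b \<and> (\<forall>c. c \<epsilon> b \<longrightarrow> \<not> Q c)"
proof (cases "\<exists>c. c \<epsilon> a \<and> Q c")
  case True
  \<comment> \<open>Foundation gives a minimal element of the subset of \<open>a\<close> separated
    by \<open>Q\<close>; transitivity of \<open>a\<close> makes it minimal outright.\<close>
  then obtain b where "b \<epsilon> a" "Q b" "\<And>c. c \<epsilon> b \<Longrightarrow> \<not> (c \<epsilon> a \<and> Q c)"
    using foundation[of "coll (\<lambda>z. z \<epsilon> a \<and> Q z)"] by (auto simp: mem_sep[OF assms(1)])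
  then show ?thesis using assms(2) Ord_mem Ord_trans by blast
next
  case False
  then show ?thesis using assms by blast
qed

lemma Ord_induct:
  assumes "pdef (\<lambda>e. Q (e 0))" "\<And>a. Ord a \<Longrightarrow> (\<And>b. b \<epsilon> a \<Longrightarrow> Q b) \<Longrightarrow> Q a" "Ord a"
  shows "Q a"
proof (rule ccontr)
  assume "\<not> Q a"
  with Ord_least[OF pdef_not[OF assms(1)] assms(3)] show False
    using assms(2) by blast
qed

text \<open>Nested induction on both ordinals: if \<open>a\<close> and \<open>b\<close> are
  incomparable while the elements of \<open>a\<close> are comparable to \<open>b\<close> and those
  of \<open>b\<close> to \<open>a\<close>, then transitivity gives \<open>a\<close> and
  \<open>b\<close> the same elements.\<close>

lemma Ord_linear:
  assumes "Ord a" "Ord b"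
  shows "a \<epsilon> b \<or> a = b \<or> b \<epsilon> a"
proof -
  have "\<forall>b. Ord b \<longrightarrow> a \<epsilon> b \<or> a = b \<or> b \<epsilon> a"
  proof (rule Ord_induct[where Q = "\<lambda>a. \<forall>b. Ord b \<longrightarrow> a \<epsilon> b \<or> a = b \<or> b \<epsilon> a", OF _ _ assms(1)])
    fix a assume a: "Ord a" and IH: "\<And>c. c \<epsilon> a \<Longrightarrow> \<forall>b. Ord b \<longrightarrow> c \<epsilon> b \<or> c = b \<or> b \<epsilon> c"
    show "\<forall>b. Ord b \<longrightarrow> a \<epsilon> b \<or> a = b \<or> b \<epsilon> a"
    proof (intro allI impI)
      fix b assume "Ord b"
      then show "a \<epsilon> b \<or> a = b \<or> b \<epsilon> a"
      proof (rule Ord_induct[where Q = "\<lambda>b. a \<epsilon> b \<or> a = b \<or> b \<epsilon> a", rotated 2])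
        fix b assume b: "Ord b" and IH': "\<And>c. c \<epsilon> b \<Longrightarrow> a \<epsilon> c \<or> a = c \<or> c \<epsilon> a"
        show "a \<epsilon> b \<or> a = b \<or> b \<epsilon> a"
        proof (rule ccontr)
          assume n: "\<not> ?thesis"
          have "z \<epsilon> a \<longleftrightarrow> z \<epsilon> b" for z
            using n a b IH IH' Ord_trans by blast
          then show False using n extI by blast
        qed
      qed (intro defn)
    qed
  qed (intro defn)
  then show ?thesis using assms(2) by blast
qed

lemma Ord_subset: "Ord a \<Longrightarrow> Ord b \<Longrightarrow> subset a b \<longleftrightarrow> a = b \<or> a \<epsilon> b"
  using Ord_linear no_self Ord_trans unfolding subset_def by blast

text \<open>The Burali-Forti argument: the set of all ordinals would be an ordinal and hence an
  element of itself.\<close>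

lemma not_set_of_all_ordinals: "\<not> (\<forall>a. Ord a \<longrightarrow> a \<epsilon> x)"
proof
  assume x: "\<forall>a. Ord a \<longrightarrow> a \<epsilon> x"
  have *: "z \<epsilon> coll Ord \<longleftrightarrow> Ord z" for z
    by (rule mem_bounded[where x = x]) (use x in \<open>auto intro: defn\<close>)
  have "Ord (coll Ord)"
    by (rule OrdI) (auto simp: * intro: Ord_mem)
  then show False using * no_self by blast
qed

section \<open>Recursion on ordinals\<close>

text \<open>An attempt at the recursion with domain \<open>a\<close>. The rule \<open>G\<close>
  receives a parameter, the stage and the restriction of the attempt to earlier stages.\<close>

definition approx :: "('v \<Rightarrow> 'v \<Rightarrow> 'v \<Rightarrow> 'v) \<Rightarrow> 'v \<Rightarrow> 'v \<Rightarrow> 'v \<Rightarrow> bool" where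
  "approx G p h a \<longleftrightarrow> h = lam a (\<lambda>b. G p b (lam b (app h)))"

text \<open>Instead of selecting an attempt, the values of all attempts at \<open>a\<close> are
  united; since these values agree, the union is the common value.\<close>

definition Rec :: "('v \<Rightarrow> 'v \<Rightarrow> 'v \<Rightarrow> 'v) \<Rightarrow> 'v \<Rightarrow> 'v \<Rightarrow> 'v" where
  "Rec G p a = coll (\<lambda>z. \<exists>h. approx G p h (succ a) \<and> z \<epsilon> app h a)"

lemma approx_pdef:
  assumes "tm (\<lambda>e. G (e 0) (e 1) (e 2))" "tm p" "tm h" "tm a"
  shows "pdef (\<lambda>e. approx G (p e) (h e) (a e))"
  by (rule pdef3[where R = "approx G", OF _ assms(2-4)]) (simp only: approx_def, intro defn tm3[where F = G, OF assms(1)])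

lemma Rec_tm:
  assumes "tm (\<lambda>e. G (e 0) (e 1) (e 2))" "tm p" "tm a"
  shows "tm (\<lambda>e. Rec G (p e) (a e))"
  by (rule tm2[where F = "Rec G", OF _ assms(2,3)]) (simp only: Rec_def, intro defn approx_pdef[OF assms(1)])

lemma lam_cong: "(\<And>x. x \<epsilon> X \<Longrightarrow> F x = F' x) \<Longrightarrow> lam X F = lam X F'"
  by (rule arg_cong[where f = coll]) (metis (no_types))

lemma approx_unique:
  assumes G: "tm (\<lambda>e. G (e 0) (e 1) (e 2))"
    and h: "Ord a" "approx G p h a" "Ord b" "approx G p k b"
    and c: "Ord c" "c \<epsilon> a" "c \<epsilon> b"
  shows "app h c = app k c"
proof -
  have app: "app h c = G p c (lam c (app h))" if c: "c \<epsilon> a" and h: "approx G p h a" for a c h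
  proof -
    have "tm (\<lambda>e. G p (e 0) (lam (e 0) (app h)))"
      by (intro defn tm3[where F = G, OF G])
    from app_lam[of "\<lambda>b. G p b (lam b (app h))", OF this c]
    show ?thesis
      by (rule trans[OF arg_cong[where f = "\<lambda>h. app h c", OF h[unfolded approx_def]]])
  qed
  have "c \<epsilon> a \<longrightarrow> c \<epsilon> b \<longrightarrow> app h c = app k c"
  proof (rule Ord_induct[where Q = "\<lambda>c. c \<epsilon> a \<longrightarrow> c \<epsilon> b \<longrightarrow> app h c = app k c", OF _ _ c(1)])
    fix c assume "Ord c" and IH: "\<And>d. d \<epsilon> c \<Longrightarrow> d \<epsilon> a \<longrightarrow> d \<epsilon> b \<longrightarrow> app h d = app k d"
    show "c \<epsilon> a \<longrightarrow> c \<epsilon> b \<longrightarrow> app h c = app k c"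
    proof (intro impI)
      assume c: "c \<epsilon> a" "c \<epsilon> b"
      have "lam c (app h) = lam c (app k)"
        by (rule lam_cong) (use IH c h Ord_trans in blast)
      then show "app h c = app k c"
        using app[OF c(1) h(2)] app[OF c(2) h(4)] by simp
    qed
  qed (intro defn)
  then show ?thesis using c by blast
qed

text \<open>The induction hypothesis says that \<open>Rec G p\<close> satisfies the recursion below
  \<open>a\<close>, so the graph of \<open>F\<close> on \<open>succ a\<close> is an attempt. By
  \<open>approx_unique\<close> every other attempt has the same value at \<open>a\<close>.\<close>

lemma Rec_eq:
  assumes G: "tm (\<lambda>e. G (e 0) (e 1) (e 2))" and a: "Ord a"
  shows "Rec G p a = G p a (lam a (Rec G p))"
proof (rule Ord_induct[where Q = "\<lambda>a. Rec G p a = G p a (lam a (Rec G p))", OF _ _ a])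
  note R = Rec_tm[OF G]
  show "pdef (\<lambda>e. Rec G p (e 0) = G p (e 0) (lam (e 0) (Rec G p)))"
    by (intro defn R tm3[where F = G, OF G])
  fix a assume a: "Ord a" and IH: "\<And>b. b \<epsilon> a \<Longrightarrow> Rec G p b = G p b (lam b (Rec G p))"
  define F where "F b = G p b (lam b (Rec G p))" for b
  have F: "tm (\<lambda>e. F (s e))" if "tm s" for s
    by (rule tm1[where F = F]) (simp only: F_def, intro defn R tm3[where F = G, OF G] that, rule that)
  define h where "h = lam (succ a) F"
  have app_h: "app h b = F b" if "b \<epsilon> succ a" for b
    unfolding h_def by (rule app_lam[OF F that]) (rule defn)
  have "lam b (app h) = lam b (Rec G p)" if "b \<epsilon> succ a" for b
    by (rule lam_cong) (use that a in \<open>auto simp: app_h IH mem_succ F_def dest: Ord_trans\<close>)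
  then have "approx G p h (succ a)"
    unfolding approx_def h_def[unfolded F_def] by (intro lam_cong) (simp add: h_def F_def)
  moreover have "app k a = F a" if "approx G p k (succ a)" for k
    using approx_unique[OF G Ord_succ[OF a] \<open>approx G p h (succ a)\<close> Ord_succ[OF a] that a]
    by (simp add: mem_succ app_h)
  ultimately have "Rec G p a = coll (\<lambda>z. z \<epsilon> F a)"
    unfolding Rec_def by (intro arg_cong[where f = coll]) (metis (no_types))
  also have "\<dots> = F a"
    by (intro extI mem_coll) blast
  finally show "Rec G p a = G p a (lam a (Rec G p))"
    by (simp add: F_def)
qed

lemma app_lam_Rec:
  assumes "tm (\<lambda>e. G (e 0) (e 1) (e 2))" "b \<epsilon> a"
  shows "app (lam a (Rec G p)) b = Rec G p b"
  by (rule app_lam[OF _ assms(2)]) (intro Rec_tm[OF assms(1)] defn)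

text \<open>Recursion by unions: start with \<open>B p\<close> and add a contribution from each
  earlier stage. Zero, successors and limits are treated alike, which gives the single membership
  equation \<open>mem_urec\<close> for order types, sums, iterations and binary values.\<close>

definition urec :: "('v \<Rightarrow> 'v) \<Rightarrow> ('v \<Rightarrow> 'v \<Rightarrow> 'v \<Rightarrow> 'v) \<Rightarrow> 'v \<Rightarrow> 'v \<Rightarrow> 'v" where
  "urec B S = Rec (\<lambda>p a h. coll (\<lambda>z. z \<epsilon> B p \<or> (\<exists>b. b \<epsilon> a \<and> z \<epsilon> S p b (app h b))))"

lemma urec_tm:
  assumes B: "tm (\<lambda>e. B (e 0))" and S: "tm (\<lambda>e. S (e 0) (e 1) (e 2))" and "tm s" "tm t"
  shows "tm (\<lambda>e. urec B S (s e) (t e))"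
  unfolding urec_def
  by (rule Rec_tm[OF _ assms(3,4)]) (intro defn tm1[where F = B, OF B] tm3[where F = S, OF S])

lemma mem_urec:
  assumes B: "tm (\<lambda>e. B (e 0))" and S: "tm (\<lambda>e. S (e 0) (e 1) (e 2))" and a: "Ord a"
  shows "z \<epsilon> urec B S p a \<longleftrightarrow> z \<epsilon> B p \<or> (\<exists>b. b \<epsilon> a \<and> z \<epsilon> S p b (urec B S p b))"
proof -
  let ?G = "\<lambda>p a h. coll (\<lambda>z. z \<epsilon> B p \<or> (\<exists>b. b \<epsilon> a \<and> z \<epsilon> S p b (app h b)))"
  note intros = defn tm1[where F = B, OF B] tm3[where F = S, OF S] urec_tm[OF B S]
  have G: "tm (\<lambda>e. ?G (e 0) (e 1) (e 2))" by (intro intros)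
  have app: "app (lam a (urec B S p)) b = urec B S p b" if "b \<epsilon> a" for b
    unfolding urec_def by (rule app_lam_Rec[where G = ?G, OF G that])
  have eq: "urec B S p a = ?G p a (lam a (urec B S p))"
    unfolding urec_def using Rec_eq[where G = ?G, OF G a] .
  have t: "tm (\<lambda>e. S p (e 0) (app (lam a (urec B S p)) (e 0)))" by (intro intros)
  have "z \<epsilon> ?G p a (lam a (urec B S p)) \<longleftrightarrow>
      z \<epsilon> B p \<or> (\<exists>b. b \<epsilon> a \<and> z \<epsilon> S p b (app (lam a (urec B S p)) b))"
    by (rule mem_bounded[where x = "cup (B p) (sUn (img a (\<lambda>b. S p b (app (lam a (urec B S p)) b))))"])
       (intro intros, unfold mem_cup mem_UN[OF t])
  then show ?thesis
    unfolding eq[symmetric] by (simp add: app cong: conj_cong)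
qed

section \<open>Finite sets\<close>

lemma inductive_iff: "is_inductive I \<longleftrightarrow> emp \<epsilon> I \<and> (\<forall>x. x \<epsilon> I \<longrightarrow> succ x \<epsilon> I)"
proof -
  have "(\<forall>x. \<not> x \<epsilon> z) \<longleftrightarrow> z = emp" for z
    using mem_emp extI by metis
  moreover have "(\<forall>w. w \<epsilon> y \<longleftrightarrow> w \<epsilon> x \<or> w = x) \<longleftrightarrow> y = succ x" for x y
  proof
    assume "\<forall>w. w \<epsilon> y \<longleftrightarrow> w \<epsilon> x \<or> w = x"
    then show "y = succ x" by (intro extI) (auto simp: mem_succ)
  qed (auto simp: mem_succ)
  ultimately show ?thesis
    unfolding is_inductive_def by auto
qed

lemma emp_omega: "emp \<epsilon> omega"
  by (simp add: mem_omega inductive_iff)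

lemma succ_omega: "n \<epsilon> omega \<Longrightarrow> succ n \<epsilon> omega"
  by (simp add: mem_omega inductive_iff)

lemma omega_induct:
  assumes "pdef (\<lambda>e. Q (e 0))" "Q emp" "\<And>n. n \<epsilon> omega \<Longrightarrow> Q n \<Longrightarrow> Q (succ n)" "n \<epsilon> omega"
  shows "Q n"
proof -
  have "is_inductive (coll (\<lambda>z. z \<epsilon> omega \<and> Q z))"
    unfolding inductive_iff mem_sep[OF assms(1)]
    using assms(2,3) emp_omega succ_omega by blast
  then show ?thesis
    using assms(4) mem_sep[OF assms(1)] mem_omega by blast
qed

lemma Ord_omega: "Ord omega"
proof (rule OrdI)
  show "c \<epsilon> omega" if "b \<epsilon> omega" "c \<epsilon> b" for b c
  proof -
    have "\<forall>c. c \<epsilon> b \<longrightarrow> c \<epsilon> omega"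
      by (rule omega_induct[where Q = "\<lambda>b. \<forall>c. c \<epsilon> b \<longrightarrow> c \<epsilon> omega", OF _ _ _ that(1)])
         (intro defn, auto simp: mem_emp mem_succ)
    then show ?thesis using that by blast
  qed
  show "Ord b" if "b \<epsilon> omega" for b
    by (rule omega_induct[where Q = Ord, OF _ _ _ that]) (intro defn, auto intro: Ord_emp Ord_succ)
qed

lemma finite_emp: "is_finite emp"
  unfolding is_finite_def
  by (rule exI[of _ emp], rule exI[of _ emp])
     (simp add: emp_omega mem_emp is_bijection_def is_injection_def is_function_def)

lemma ins_absorb: "a \<epsilon> X \<Longrightarrow> ins a X = X"
  by (rule extI) (auto simp: mem_ins)

lemma finite_ins:
  assumes "is_finite X"
  shows "is_finite (ins a X)"
proof (cases "a \<epsilon> X")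
  case False
  obtain n f where n: "n \<epsilon> omega" and f: "is_bijection f n X"
    using assms unfolding is_finite_def by blast
  let ?g = "ins (opair n a) f"
  have ff: "is_function f n X" and inj: "\<And>x x' y. opair x y \<epsilon> f \<Longrightarrow> opair x' y \<epsilon> f \<Longrightarrow> x = x'"
    and surj: "\<And>y. y \<epsilon> X \<Longrightarrow> \<exists>x. opair x y \<epsilon> f"
    using f unfolding is_bijection_def is_injection_def by blast+
  have dom: "opair x y \<epsilon> f \<Longrightarrow> x \<epsilon> n \<and> y \<epsilon> X" for x y
    using function_pair[OF ff] function_app[OF ff] by auto
  have g: "opair x y \<epsilon> ?g \<longleftrightarrow> x = n \<and> y = a \<or> opair x y \<epsilon> f" for x y
    by (auto simp: mem_ins opair_eq_iff)
  have "is_function ?g (succ n) (ins a X)"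
    unfolding is_function_def
  proof (intro conjI allI impI)
    fix p assume "p \<epsilon> ?g"
    then show "\<exists>x y. x \<epsilon> succ n \<and> y \<epsilon> ins a X \<and> p = opair x y"
      using ff unfolding mem_ins mem_succ is_function_def by blast
  next
    fix x assume "x \<epsilon> succ n"
    then show "\<exists>!y. opair x y \<epsilon> ?g"
      unfolding g mem_succ using ff dom no_self unfolding is_function_def by metis
  qed
  moreover have "x = x'" if "opair x y \<epsilon> ?g" "opair x' y \<epsilon> ?g" for x x' y
    using that inj dom False unfolding g by metis
  moreover have "\<exists>x. opair x y \<epsilon> ?g" if "y \<epsilon> ins a X" for y
    using that surj unfolding g mem_ins by metis
  ultimately have "is_bijection ?g (succ n) (ins a X)"
    unfolding is_bijection_def is_injection_def by blast
  then show ?thesis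
    unfolding is_finite_def using succ_omega[OF n] by blast
qed (use assms ins_absorb in simp)

text \<open>Induction on the length of an enumeration, for all sets at once: deleting the last value
  of an enumeration by \<open>succ n\<close> leaves a set enumerated by \<open>n\<close>.\<close>

lemma finite_induct:
  assumes Q: "pdef (\<lambda>e. Q (e 0))" "Q emp" "\<And>a X. is_finite X \<Longrightarrow> Q X \<Longrightarrow> Q (ins a X)"
    and X: "is_finite X"
  shows "Q X"
proof -
  obtain n f where n: "n \<epsilon> omega" and f: "is_bijection f n X"
    using X unfolding is_finite_def by blast
  have "\<forall>X. (\<exists>f. is_bijection f n X) \<longrightarrow> Q X"
  proof (rule omega_induct[where Q = "\<lambda>n. \<forall>X. (\<exists>f. is_bijection f n X) \<longrightarrow> Q X", OF _ _ _ n])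
    show "pdef (\<lambda>e. \<forall>X. (\<exists>f. is_bijection f (e 0) X) \<longrightarrow> Q X)"
      by (intro defn pdef1[where R = Q, OF Q(1)])
    have "X = emp" if "is_bijection f emp X" for f X
      by (rule extI) (use that in \<open>auto simp: is_bijection_def is_injection_def is_function_def mem_emp opair_eq_iff\<close>)
    then show "\<forall>X. (\<exists>f. is_bijection f emp X) \<longrightarrow> Q X"
      using Q(2) by blast
  next
    fix n assume n: "n \<epsilon> omega" and IH: "\<forall>X. (\<exists>f. is_bijection f n X) \<longrightarrow> Q X"
    show "\<forall>X. (\<exists>f. is_bijection f (succ n) X) \<longrightarrow> Q X"
    proof (intro allI impI)
      fix X assume "\<exists>f. is_bijection f (succ n) X"
      then obtain f where f: "is_bijection f (succ n) X" by blast
      let ?a = "app f n" and ?Y = "coll (\<lambda>z. z \<epsilon> X \<and> z \<noteq> app f n)"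
      have Y: "z \<epsilon> ?Y \<longleftrightarrow> z \<epsilon> X \<and> z \<noteq> ?a" for z
        by (rule mem_sep) (intro defn)
      have inj: "is_injection f (succ n) X" and fn: "is_function f (succ n) X"
        using f unfolding is_bijection_def is_injection_def by blast+
      have surj: "\<exists>x. x \<epsilon> succ n \<and> app f x = y" if "y \<epsilon> X" for y
      proof -
        obtain x where "opair x y \<epsilon> f"
          using f \<open>y \<epsilon> X\<close> unfolding is_bijection_def by blast
        then show ?thesis
          unfolding function_pair[OF fn] by metis
      qed
      have t: "tm (\<lambda>e. app f (e 0))" by (intro defn)
      have "is_injection (lam n (app f)) n ?Y"
      proof (rule lam_injection[OF t])
        show "app f x \<epsilon> ?Y" if "x \<epsilon> n" for x
          unfolding Y using that injection_app[OF inj] no_self mem_succ by metis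
        show "x = y" if "x \<epsilon> n" "y \<epsilon> n" "app f x = app f y" for x y
          using that injection_app(2)[OF inj] mem_succ by metis
      qed
      moreover have "\<exists>x. opair x y \<epsilon> lam n (app f)" if "y \<epsilon> ?Y" for y
        using that surj by (auto simp: Y mem_lam[OF t] mem_succ opair_eq_iff)
      ultimately have "is_bijection (lam n (app f)) n ?Y"
        unfolding is_bijection_def by blast
      then have "is_finite ?Y" "Q ?Y"
        using IH n unfolding is_finite_def by blast+
      moreover have "X = ins ?a ?Y"
        by (rule extI) (use injection_app[OF inj, of n] in \<open>auto simp: mem_ins Y mem_succ\<close>)
      ultimately show "Q X" using Q(3) by metis
    qed
  qed
  then show ?thesis using f by blast
qed

lemma finite_subset:
  assumes "is_finite X" "subset Y X"
  shows "is_finite Y"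
proof -
  have "\<forall>Y. subset Y X \<longrightarrow> is_finite Y"
  proof (rule finite_induct[where Q = "\<lambda>X. \<forall>Y. subset Y X \<longrightarrow> is_finite Y", OF _ _ _ assms(1)])
    show "\<forall>Y. subset Y emp \<longrightarrow> is_finite Y"
      using finite_emp extI mem_emp unfolding subset_def by metis
    fix a X assume IH: "\<forall>Y. subset Y X \<longrightarrow> is_finite Y"
    show "\<forall>Y. subset Y (ins a X) \<longrightarrow> is_finite Y"
    proof (intro allI impI)
      fix Y assume Y: "subset Y (ins a X)"
      let ?Z = "coll (\<lambda>z. z \<epsilon> Y \<and> z \<noteq> a)"
      have Z: "z \<epsilon> ?Z \<longleftrightarrow> z \<epsilon> Y \<and> z \<noteq> a" for z
        by (rule mem_sep) (intro defn)
      have f: "is_finite ?Z"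
        by (rule IH[rule_format]) (use Y in \<open>auto simp: subset_def Z mem_ins\<close>)
      have "Y = (if a \<epsilon> Y then ins a ?Z else ?Z)"
        by (rule extI) (auto simp: mem_ins Z)
      then show "is_finite Y"
        using f finite_ins by metis
    qed
  qed (intro defn)
  then show ?thesis using assms(2) by blast
qed

lemma finite_cup:
  assumes "is_finite X" "is_finite Y"
  shows "is_finite (cup X Y)"
proof (rule finite_induct[where Q = "\<lambda>X. is_finite (cup X Y)", OF _ _ _ assms(1)])
  have "cup emp Y = Y" by (rule extI) (simp add: mem_cup mem_emp)
  then show "is_finite (cup emp Y)" using assms by simp
  fix a X assume "is_finite (cup X Y)"
  moreover have "cup (ins a X) Y = ins a (cup X Y)"
    by (rule extI) (auto simp: mem_cup mem_ins)
  ultimately show "is_finite (cup (ins a X) Y)" using finite_ins by simp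
qed (intro defn)

lemma finite_upair: "is_finite (upair a b)"
proof -
  have "upair a b = ins a (ins b emp)"
    by (rule extI) (auto simp: mem_upair mem_ins mem_emp)
  then show ?thesis using finite_emp finite_ins by metis
qed

lemma finite_img:
  assumes F: "tm (\<lambda>e. F (e 0))" and X: "is_finite X"
  shows "is_finite (img X F)"
proof (rule finite_induct[where Q = "\<lambda>X. is_finite (img X F)", OF _ _ _ X])
  show "pdef (\<lambda>e. is_finite (img (e 0) F))"
    by (intro defn tm1[where F = F, OF F])
  have "img emp F = emp" by (rule extI) (simp add: mem_img[OF F] mem_emp)
  then show "is_finite (img emp F)" using finite_emp by simp
  fix a X assume "is_finite (img X F)"
  moreover have "img (ins a X) F = ins (F a) (img X F)"
    by (rule extI) (auto simp: mem_img[OF F] mem_ins)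
  ultimately show "is_finite (img (ins a X) F)" using finite_ins by simp
qed

lemma finite_sUn:
  assumes "is_finite X" "\<And>x. x \<epsilon> X \<Longrightarrow> is_finite x"
  shows "is_finite (sUn X)"
proof -
  have "(\<forall>x. x \<epsilon> X \<longrightarrow> is_finite x) \<longrightarrow> is_finite (sUn X)"
  proof (rule finite_induct[where Q = "\<lambda>X. (\<forall>x. x \<epsilon> X \<longrightarrow> is_finite x) \<longrightarrow> is_finite (sUn X)", OF _ _ _ assms(1)])
    have "sUn emp = emp" by (rule extI) (simp add: mem_sUn mem_emp)
    then show "(\<forall>x. x \<epsilon> emp \<longrightarrow> is_finite x) \<longrightarrow> is_finite (sUn emp)" using finite_emp by simp
    fix a X assume "(\<forall>x. x \<epsilon> X \<longrightarrow> is_finite x) \<longrightarrow> is_finite (sUn X)"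
    moreover have "sUn (ins a X) = cup a (sUn X)"
      by (rule extI) (auto simp: mem_sUn mem_ins mem_cup)
    ultimately show "(\<forall>x. x \<epsilon> ins a X \<longrightarrow> is_finite x) \<longrightarrow> is_finite (sUn (ins a X))"
      using finite_cup by (simp add: mem_ins)
  qed (intro defn)
  then show ?thesis using assms(2) by blast
qed

lemma finite_pow:
  assumes "is_finite X"
  shows "is_finite (pow X)"
proof (rule finite_induct[where Q = "\<lambda>X. is_finite (pow X)", OF _ _ _ assms])
  have "pow emp = ins emp emp"
    by (rule extI) (metis mem_pow mem_ins mem_emp subset_def extI)
  then show "is_finite (pow emp)" using finite_emp finite_ins by simp
  fix a X assume f: "is_finite (pow X)"
  have t: "tm (\<lambda>e. ins a (e 0))" by (intro defn)
  have "subset (pow (ins a X)) (cup (pow X) (img (pow X) (ins a)))"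
    unfolding subset_def[of "pow _"]
  proof (intro allI impI)
    fix Y assume Y: "Y \<epsilon> pow (ins a X)"
    let ?Z = "coll (\<lambda>z. z \<epsilon> Y \<and> z \<noteq> a)"
    have Z: "z \<epsilon> ?Z \<longleftrightarrow> z \<epsilon> Y \<and> z \<noteq> a" for z
      by (rule mem_sep) (intro defn)
    have "Y = (if a \<epsilon> Y then ins a ?Z else ?Z)"
      by (rule extI) (auto simp: mem_ins Z)
    moreover have "?Z \<epsilon> pow X"
      using Y by (auto simp: mem_pow subset_def Z mem_ins)
    ultimately show "Y \<epsilon> cup (pow X) (img (pow X) (ins a))"
      unfolding mem_cup mem_img[OF t] by metis
  qed
  moreover have "is_finite (cup (pow X) (img (pow X) (ins a)))"
    by (intro finite_cup finite_img f t)
  ultimately show "is_finite (pow (ins a X))" using finite_subset by blast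
qed (intro defn)

section \<open>Finiteness from maps into finite sets\<close>

lemma finite_fibres:
  assumes F: "tm (\<lambda>e. F (e 0))" and Y: "is_finite Y" "\<And>x. x \<epsilon> X \<Longrightarrow> F x \<epsilon> Y"
    and fib: "\<And>y. y \<epsilon> Y \<Longrightarrow> is_finite (coll (\<lambda>x. x \<epsilon> X \<and> F x = y))"
  shows "is_finite X"
proof -
  define K where "K y = coll (\<lambda>x. x \<epsilon> X \<and> F x = y)" for y
  have t: "tm (\<lambda>e. K (e 0))"
    unfolding K_def by (intro defn tm1[where F = F, OF F])
  have K: "x \<epsilon> K y \<longleftrightarrow> x \<epsilon> X \<and> F x = y" for x y
    unfolding K_def by (rule mem_sep) (intro defn F)
  have "is_finite (sUn (img Y K))"
  proof (rule finite_sUn[OF finite_img[OF t Y(1)]])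
    show "\<And>x. x \<epsilon> img Y K \<Longrightarrow> is_finite x"
      using fib by (auto simp: mem_img[OF t] K_def)
  qed
  moreover have "subset X (sUn (img Y K))"
    using Y(2) by (auto simp: subset_def mem_UN[OF t] K)
  ultimately show ?thesis using finite_subset by blast
qed

lemma finite_inj:
  assumes F: "tm (\<lambda>e. F (e 0))" and Y: "is_finite Y" "\<And>x. x \<epsilon> X \<Longrightarrow> F x \<epsilon> Y"
    and inj: "\<And>x y. x \<epsilon> X \<Longrightarrow> y \<epsilon> X \<Longrightarrow> F x = F y \<Longrightarrow> x = y"
  shows "is_finite X"
proof (rule finite_fibres[OF F Y])
  fix y
  have K: "x \<epsilon> coll (\<lambda>x. x \<epsilon> X \<and> F x = y) \<longleftrightarrow> x \<epsilon> X \<and> F x = y" for x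
    by (rule mem_sep) (intro defn F)
  show "is_finite (coll (\<lambda>x. x \<epsilon> X \<and> F x = y))"
  proof (cases "\<exists>x. x \<epsilon> X \<and> F x = y")
    case True
    then obtain x where "x \<epsilon> X" "F x = y" by blast
    then have "subset (coll (\<lambda>x. x \<epsilon> X \<and> F x = y)) (upair x x)"
      using inj by (auto simp: subset_def K mem_upair)
    then show ?thesis using finite_upair finite_subset by blast
  next
    case False
    then have "subset (coll (\<lambda>x. x \<epsilon> X \<and> F x = y)) emp"
      by (auto simp: subset_def K)
    then show ?thesis using finite_emp finite_subset by blast
  qed
qed auto

section \<open>Dedekind infinite sets and finite ordinals\<close>

lemma dedekind_infiniteI:
  assumes F: "tm (\<lambda>e. F (e 0))" "\<And>x. x \<epsilon> omega \<Longrightarrow> F x \<epsilon> X"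
    "\<And>x y. x \<epsilon> omega \<Longrightarrow> y \<epsilon> omega \<Longrightarrow> F x = F y \<Longrightarrow> x = y"
  shows "dedekind_infinite X"
  unfolding dedekind_infinite_def using lam_injection[OF assms] by blast

lemma succ_inj:
  assumes "succ m = succ n"
  shows "m = n"
proof -
  have "m \<epsilon> succ n" using mem_succ[of m m] assms by simp
  moreover have "n \<epsilon> succ m" using mem_succ[of n n] assms by simp
  ultimately show ?thesis using no_cycle unfolding mem_succ by blast
qed

text \<open>If \<open>f m = a\<close>, then \<open>n \<mapsto> f (n + 1)\<close> for \<open>n \<ge> m\<close> and \<open>n \<mapsto> f n\<close> for \<open>n < m\<close> avoids \<open>a\<close>.\<close>

lemma finite_not_dedekind_infinite:
  assumes "is_finite X"
  shows "\<not> dedekind_infinite X"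
proof (rule finite_induct[where Q = "\<lambda>X. \<not> dedekind_infinite X", OF _ _ _ assms])
  show "\<not> dedekind_infinite emp"
    using injection_app(1)[OF _ emp_omega] mem_emp unfolding dedekind_infinite_def by blast
  fix a X assume IH: "\<not> dedekind_infinite X"
  show "\<not> dedekind_infinite (ins a X)"
  proof
    assume "dedekind_infinite (ins a X)"
    then obtain f where "is_injection f omega (ins a X)"
      unfolding dedekind_infinite_def by blast
    note f = injection_app[OF this]
    have "dedekind_infinite X"
    proof (cases "\<exists>m. m \<epsilon> omega \<and> app f m = a")
      case False
      show ?thesis
        by (rule dedekind_infiniteI[where F = "app f"]) (use False f in \<open>auto simp: mem_ins intro: defn\<close>)
    next
      case True
      then obtain m where m: "m \<epsilon> omega" "app f m = a" by blast
      \<comment> \<open>The case distinction is written as a comprehension so that \<open>F\<close>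
        is visibly a definable term; the next fact turns it back into a conditional.\<close>
      define F where "F n = coll (\<lambda>z. n \<epsilon> m \<and> z \<epsilon> app f n \<or> \<not> n \<epsilon> m \<and> z \<epsilon> app f (succ n))" for n
      have F: "F n = (if n \<epsilon> m then app f n else app f (succ n))" for n
        unfolding F_def by (rule extI, subst mem_coll) (auto)
      have o: "Ord m" "\<And>n. n \<epsilon> omega \<Longrightarrow> Ord n"
        using m Ord_omega Ord_mem by auto
      have sm: "succ n \<noteq> m" if "\<not> n \<epsilon> m" for n
        using that by (auto simp: mem_succ)
      show ?thesis
      proof (rule dedekind_infiniteI[where F = F])
        show "tm (\<lambda>e. F (e 0))" unfolding F_def by (intro defn)
        show "F n \<epsilon> X" if n: "n \<epsilon> omega" for n
        proof (cases "n \<epsilon> m")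
          case True
          then have "app f n \<noteq> a" using f(2)[OF n m(1)] m(2) no_self by metis
          then show ?thesis using f(1)[OF n] True by (auto simp: F mem_ins)
        next
          case False
          then have "app f (succ n) \<noteq> a" using f(2)[OF succ_omega[OF n] m(1)] m(2) sm by metis
          then show ?thesis using f(1)[OF succ_omega[OF n]] False by (auto simp: F mem_ins)
        qed
        show "x = y" if "x \<epsilon> omega" "y \<epsilon> omega" "F x = F y" for x y
        proof -
          have "x \<noteq> succ y" if "x \<epsilon> m" "\<not> y \<epsilon> m" for x y
            using that o(1) Ord_trans[of m x y] by (auto simp: mem_succ)
          then show ?thesis
            using that f(2) succ_omega succ_inj unfolding F by (smt (verit))
        qed
      qed
    qed
    with IH show False ..
  qed
qed (intro defn)

lemma omega_not_finite: "\<not> is_finite omega"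
  using finite_not_dedekind_infinite dedekind_infiniteI[where F = "\<lambda>x. x" and X = omega] tm_var by blast

lemma finite_Ord: "Ord a \<Longrightarrow> is_finite a \<longleftrightarrow> a \<epsilon> omega"
proof
  assume a: "Ord a" "is_finite a"
  then have "\<not> subset omega a"
    using finite_subset omega_not_finite by blast
  then show "a \<epsilon> omega"
    using Ord_linear[OF a(1) Ord_omega] a(1) Ord_trans unfolding subset_def by blast
next
  show "is_finite a" if "a \<epsilon> omega"
    unfolding is_finite_def is_bijection_def
  proof (intro exI conjI allI impI)
    show "a \<epsilon> omega" by fact
    show "is_injection (lam a (\<lambda>x. x)) a a"
      by (rule lam_injection) (auto intro: defn)
    fix y assume "y \<epsilon> a"
    then show "opair y y \<epsilon> lam a (\<lambda>x. x)"
      by (subst mem_lam) (auto intro: defn)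
  qed
qed

section \<open>Order types of sets of ordinals\<close>

text \<open>The Mostowski collapse of \<open>J\<close>: its value at \<open>b\<close> is the order
  type of the part of \<open>J\<close> below \<open>b\<close>. Each element of \<open>J\<close>
  contributes the singleton of its own value.\<close>

definition otp :: "'v \<Rightarrow> 'v \<Rightarrow> 'v" where
  "otp = urec (\<lambda>J. emp) (\<lambda>J b x. coll (\<lambda>z. b \<epsilon> J \<and> z = x))"

lemma otp_tm [defn]: "tm s \<Longrightarrow> tm t \<Longrightarrow> tm (\<lambda>e. otp (s e) (t e))"
  unfolding otp_def by (rule urec_tm) (intro defn)+

lemma mem_otp:
  assumes "Ord a"
  shows "z \<epsilon> otp J a \<longleftrightarrow> (\<exists>b. b \<epsilon> a \<and> b \<epsilon> J \<and> z = otp J b)"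
proof -
  have "z \<epsilon> coll (\<lambda>z. b \<epsilon> J \<and> z = x) \<longleftrightarrow> b \<epsilon> J \<and> z = x" for b z x
    by (rule mem_bounded[where x = "upair x x"]) (intro defn, simp add: mem_upair)
  then show ?thesis
    unfolding otp_def by (subst mem_urec) (intro defn assms | simp add: mem_emp)+
qed

lemma Ord_otp:
  assumes "Ord a"
  shows "Ord (otp J a)"
proof (rule Ord_induct[where Q = "\<lambda>a. Ord (otp J a)", OF _ _ assms])
  fix a assume a: "Ord a" "\<And>b. b \<epsilon> a \<Longrightarrow> Ord (otp J b)"
  show "Ord (otp J a)"
  proof (rule OrdI)
    fix b c assume "b \<epsilon> otp J a" "c \<epsilon> b"
    then obtain d where d: "d \<epsilon> a" "c \<epsilon> otp J d"
      unfolding mem_otp[OF a(1)] by blast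
    then show "c \<epsilon> otp J a"
      unfolding mem_otp[OF a(1)] mem_otp[OF Ord_mem[OF a(1) d(1)]] using Ord_trans[OF a(1)] by blast
  qed (use a in \<open>auto simp: mem_otp\<close>)
qed (intro defn)

lemma otp_mono: "Ord a \<Longrightarrow> b \<epsilon> a \<Longrightarrow> b \<epsilon> J \<Longrightarrow> otp J b \<epsilon> otp J a"
  using mem_otp by blast

lemma otp_inj: "Ord a \<Longrightarrow> Ord b \<Longrightarrow> a \<epsilon> J \<Longrightarrow> b \<epsilon> J \<Longrightarrow> otp J a = otp J b \<Longrightarrow> a = b"
  using Ord_linear[of a b] otp_mono[of a b J] otp_mono[of b a J] no_self by metis

lemma Ord_otp_img:
  assumes "\<And>j. j \<epsilon> J \<Longrightarrow> Ord j"
  shows "Ord (img J (otp J))"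
proof -
  have t: "tm (\<lambda>e. otp J (e 0))" by (intro defn)
  show ?thesis
  proof (rule OrdI)
    fix b c assume "b \<epsilon> img J (otp J)" "c \<epsilon> b"
    then obtain j where "j \<epsilon> J" "c \<epsilon> otp J j"
      unfolding mem_img[OF t] by blast
    then show "c \<epsilon> img J (otp J)"
      unfolding mem_img[OF t] mem_otp[OF assms[OF \<open>j \<epsilon> J\<close>]] by blast
  qed (use assms Ord_otp in \<open>auto simp: mem_img[OF t]\<close>)
qed

text \<open>The collapse is injective on \<open>J\<close>, so its image is an infinite ordinal and
  contains \<omega>.\<close>

lemma infinite_otp_img:
  assumes J: "\<And>j. j \<epsilon> J \<Longrightarrow> Ord j" and inf: "\<not> is_finite J"
  shows "subset omega (img J (otp J))"
proof -
  have t: "tm (\<lambda>e. otp J (e 0))" by (intro defn)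
  have "\<not> is_finite (img J (otp J))"
    using finite_inj[OF t, of "img J (otp J)" J] otp_inj J inf by (auto simp: mem_img[OF t])
  then show ?thesis
    using finite_Ord Ord_otp_img[OF J] Ord_linear[OF Ord_omega Ord_otp_img[OF J]] Ord_subset[OF Ord_omega]
    by blast
qed

text \<open>\<open>J\<close> is well-ordered, so its collapse can be inverted on \<omega> without
  choice; \<open>F\<close> is this inverse. Thus a Dedekind finite set of ordinals is
  finite.\<close>

lemma infinite_dedekind_infinite:
  assumes J: "\<And>j. j \<epsilon> J \<Longrightarrow> Ord j" and inf: "\<not> is_finite J"
  shows "dedekind_infinite J"
proof -
  have t: "tm (\<lambda>e. otp J (e 0))" by (intro defn)
  define F where "F n = coll (\<lambda>z. \<exists>j. j \<epsilon> J \<and> otp J j = n \<and> z \<epsilon> j)" for n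
  have F: "F (otp J j) = j" if "j \<epsilon> J" for j
    unfolding F_def using that J otp_inj
    by (intro extI, subst mem_bounded[where x = j]) (auto intro!: defn, blast+)
  show ?thesis
  proof (rule dedekind_infiniteI[where F = F])
    show "tm (\<lambda>e. F (e 0))" unfolding F_def by (intro defn)
    have *: "\<exists>j. j \<epsilon> J \<and> n = otp J j" if "n \<epsilon> omega" for n
      using infinite_otp_img[OF J inf] that by (auto simp: subset_def mem_img[OF t])
    show "F x \<epsilon> J" if "x \<epsilon> omega" for x
      using *[OF that] F by auto
    show "x = y" if "x \<epsilon> omega" "y \<epsilon> omega" "F x = F y" for x y
      using *[OF that(1)] *[OF that(2)] F that(3) by auto
  qed
qed

section \<open>Ordinal addition\<close>

definition add :: "'v \<Rightarrow> 'v \<Rightarrow> 'v" where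
  "add = urec (\<lambda>d. d) (\<lambda>d y z. upair z z)"

lemma add_tm [defn]: "tm s \<Longrightarrow> tm t \<Longrightarrow> tm (\<lambda>e. add (s e) (t e))"
  unfolding add_def by (rule urec_tm) (intro defn)+

lemma mem_add: "Ord x \<Longrightarrow> z \<epsilon> add d x \<longleftrightarrow> z \<epsilon> d \<or> (\<exists>y. y \<epsilon> x \<and> z = add d y)"
  unfolding add_def by (subst mem_urec) (intro defn | simp add: mem_upair)+

lemma Ord_add:
  assumes d: "Ord d" and x: "Ord x"
  shows "Ord (add d x)"
proof (rule Ord_induct[where Q = "\<lambda>x. Ord (add d x)", OF _ _ x])
  fix x assume x: "Ord x" and IH: "\<And>y. y \<epsilon> x \<Longrightarrow> Ord (add d y)"
  show "Ord (add d x)"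
  proof (rule OrdI)
    fix b c assume "b \<epsilon> add d x" "c \<epsilon> b"
    then consider "c \<epsilon> d" | y where "y \<epsilon> x" "c \<epsilon> add d y"
      unfolding mem_add[OF x] using Ord_trans[OF d] by blast
    then show "c \<epsilon> add d x"
    proof cases
      case 2
      then show ?thesis
        unfolding mem_add[OF x] mem_add[OF Ord_mem[OF x 2(1)]] using Ord_trans[OF x] by blast
    qed (simp add: mem_add[OF x])
  qed (use IH Ord_mem[OF d] in \<open>auto simp: mem_add[OF x]\<close>)
qed (intro defn)

lemma add_mono: "Ord x \<Longrightarrow> y \<epsilon> x \<Longrightarrow> add d y \<epsilon> add d x"
  using mem_add by blast

lemma add_left: "Ord x \<Longrightarrow> z \<epsilon> d \<Longrightarrow> z \<epsilon> add d x"
  using mem_add by blast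

lemma add_not_mem: "Ord x \<Longrightarrow> \<not> add d x \<epsilon> d"
  using add_left no_self by blast

lemma add_inj: "Ord x \<Longrightarrow> Ord y \<Longrightarrow> add d x = add d y \<Longrightarrow> x = y"
  using Ord_linear[of x y] add_mono[of x y d] add_mono[of y x d] no_self by metis

lemma add_emp: "add d emp = d"
  by (rule extI) (simp add: mem_add[OF Ord_emp] mem_emp)

lemma add_omega:
  assumes n: "n \<epsilon> omega" and m: "m \<epsilon> omega"
  shows "add n m \<epsilon> omega"
proof (rule omega_induct[where Q = "\<lambda>m. add n m \<epsilon> omega", OF _ _ _ m])
  fix m assume m: "m \<epsilon> omega" "add n m \<epsilon> omega"
  then have "Ord m" using Ord_mem[OF Ord_omega] by blast
  then have "add n (succ m) = succ (add n m)"
    by (intro extI) (auto simp: mem_add Ord_succ mem_succ)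
  then show "add n (succ m) \<epsilon> omega" using m succ_omega by simp
qed (intro defn, simp add: add_emp n)

section \<open>Increasing chains\<close>

text \<open>Transfinite iteration of \<open>st\<close> from \<open>b\<close>, with unions at limits.
  All earlier results are accumulated, so the equation \<open>chain_succ\<close> requires
  \<open>st\<close> to be increasing at that stage.\<close>

definition chain :: "('v \<Rightarrow> 'v) \<Rightarrow> 'v \<Rightarrow> 'v \<Rightarrow> 'v" where
  "chain st = urec (\<lambda>b. b) (\<lambda>b m x. st x)"

lemma chain_tm:
  assumes "tm (\<lambda>e. st (e 0))" "tm s" "tm t"
  shows "tm (\<lambda>e. chain st (s e) (t e))"
  unfolding chain_def by (rule urec_tm) (intro defn tm1[where F = st, OF assms(1)] assms)+

lemma mem_chain:
  assumes st: "tm (\<lambda>e. st (e 0))" and "Ord a"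
  shows "z \<epsilon> chain st b a \<longleftrightarrow> z \<epsilon> b \<or> (\<exists>m. m \<epsilon> a \<and> z \<epsilon> st (chain st b m))"
  unfolding chain_def by (subst mem_urec) (intro defn tm1[where F = st, OF st] assms | simp)+

lemma chain_succ:
  assumes st: "tm (\<lambda>e. st (e 0))" and a: "Ord a"
    and inc: "subset (chain st b a) (st (chain st b a))"
  shows "chain st b (succ a) = st (chain st b a)"
  using inc by (intro extI) (auto simp: mem_chain[OF st] Ord_succ[OF a] a mem_succ subset_def)

section \<open>Coding finite sets of natural numbers\<close>

text \<open>Repeated doubling from the ordinal 1: for finite \<open>n\<close> this is 2^n.\<close>

definition two_pow :: "'v \<Rightarrow> 'v" where
  "two_pow n = chain (\<lambda>x. add x x) (ins emp emp) n"

text \<open>\<open>bin s a\<close> is the ordinal with binary digits \<open>s \<inter> a\<close>; for \<open>a \<le> \<omega>\<close> the union over \<open>k \<in> s \<inter> a\<close> is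
  a maximum or a supremum.\<close>

definition bin :: "'v \<Rightarrow> 'v \<Rightarrow> 'v" where
  "bin = urec (\<lambda>s. emp) (\<lambda>s k x. coll (\<lambda>z. k \<epsilon> s \<and> z \<epsilon> add (two_pow k) x))"

lemma two_pow_tm [defn]: "tm s \<Longrightarrow> tm (\<lambda>e. two_pow (s e))"
  unfolding two_pow_def by (rule chain_tm) (intro defn)+

lemma bin_tm [defn]: "tm s \<Longrightarrow> tm t \<Longrightarrow> tm (\<lambda>e. bin (s e) (t e))"
  unfolding bin_def by (rule urec_tm) (intro defn)+

lemma mem_bin:
  assumes "Ord a"
  shows "z \<epsilon> bin s a \<longleftrightarrow> (\<exists>k. k \<epsilon> a \<and> k \<epsilon> s \<and> z \<epsilon> add (two_pow k) (bin s k))"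
proof -
  have "z \<epsilon> coll (\<lambda>z. k \<epsilon> s \<and> z \<epsilon> add (two_pow k) x) \<longleftrightarrow> k \<epsilon> s \<and> z \<epsilon> add (two_pow k) x" for z k x
    by (rule mem_bounded[where x = "add (two_pow k) x"]) (intro defn, simp)
  then show ?thesis
    unfolding bin_def by (subst mem_urec) (intro defn assms | simp add: mem_emp)+
qed

lemma omega_Ord: "n \<epsilon> omega \<Longrightarrow> Ord n"
  using Ord_mem[OF Ord_omega] .

lemma two_pow_emp: "two_pow emp = succ emp"
proof -
  have t: "tm (\<lambda>e. add (e 0) (e 0))" by (intro defn)
  show ?thesis
    unfolding two_pow_def by (rule extI) (simp add: mem_chain[OF t Ord_emp] mem_emp succ_def)
qed

lemma two_pow_succ:
  assumes "n \<epsilon> omega" "Ord (two_pow n)"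
  shows "two_pow (succ n) = add (two_pow n) (two_pow n)"
  unfolding two_pow_def
  by (rule chain_succ) (use assms omega_Ord add_left in \<open>auto simp: two_pow_def subset_def intro: defn\<close>)

lemma two_pow_omega:
  assumes "n \<epsilon> omega"
  shows "two_pow n \<epsilon> omega"
  by (rule omega_induct[where Q = "\<lambda>n. two_pow n \<epsilon> omega", OF _ _ _ assms])
     (intro defn, auto simp: two_pow_emp two_pow_succ omega_Ord intro: succ_omega emp_omega add_omega)

lemma bin_succ:
  assumes k: "k \<epsilon> omega" and b: "bin s k \<epsilon> two_pow k"
  shows "bin s (succ k) = (if k \<epsilon> s then add (two_pow k) (bin s k) else bin s k)"
proof -
  note o = omega_Ord[OF k] Ord_succ[OF omega_Ord[OF k]] omega_Ord[OF two_pow_omega[OF k]]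
  have "z \<epsilon> bin s (succ k) \<longleftrightarrow> z \<epsilon> bin s k \<or> k \<epsilon> s \<and> z \<epsilon> add (two_pow k) (bin s k)" for z
    by (auto simp: mem_bin[OF o(1)] mem_bin[OF o(2)] mem_succ)
  moreover have "z \<epsilon> add (two_pow k) (bin s k)" if "z \<epsilon> bin s k" for z
    using that Ord_trans[OF o(3) b] Ord_mem[OF o(3) b] add_left by blast
  ultimately show ?thesis
    by (intro extI) auto
qed

lemma bin_less:
  assumes "k \<epsilon> omega"
  shows "bin s k \<epsilon> two_pow k"
proof (rule omega_induct[where Q = "\<lambda>k. bin s k \<epsilon> two_pow k", OF _ _ _ assms])
  have "bin s emp = emp" by (rule extI) (simp add: mem_bin[OF Ord_emp] mem_emp)
  then show "bin s emp \<epsilon> two_pow emp" by (simp add: two_pow_emp mem_succ)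
  fix k assume k: "k \<epsilon> omega" "bin s k \<epsilon> two_pow k"
  then have "Ord (two_pow k)" using omega_Ord two_pow_omega by blast
  then show "bin s (succ k) \<epsilon> two_pow (succ k)"
    using k by (auto simp: bin_succ two_pow_succ intro: add_mono add_left)
qed (intro defn)

text \<open>The top digit can be read off: \<open>add (two_pow k) (bin s k)\<close> is not below
  \<open>two_pow k\<close>, while \<open>bin t k\<close> is. Left cancellation then removes that
  digit.\<close>

lemma bin_inj:
  assumes "k \<epsilon> omega" "bin s k = bin t k" "j \<epsilon> k"
  shows "j \<epsilon> s \<longleftrightarrow> j \<epsilon> t"
proof -
  have "bin s k = bin t k \<longrightarrow> (\<forall>j. j \<epsilon> k \<longrightarrow> (j \<epsilon> s \<longleftrightarrow> j \<epsilon> t))"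
  proof (rule omega_induct[where Q = "\<lambda>k. bin s k = bin t k \<longrightarrow> (\<forall>j. j \<epsilon> k \<longrightarrow> (j \<epsilon> s \<longleftrightarrow> j \<epsilon> t))", OF _ _ _ assms(1)])
    fix k assume k: "k \<epsilon> omega"
      and IH: "bin s k = bin t k \<longrightarrow> (\<forall>j. j \<epsilon> k \<longrightarrow> (j \<epsilon> s \<longleftrightarrow> j \<epsilon> t))"
    have o: "Ord (bin s k)" for s
      using bin_less[OF k] two_pow_omega[OF k] omega_Ord Ord_mem by blast
    show "bin s (succ k) = bin t (succ k) \<longrightarrow> (\<forall>j. j \<epsilon> succ k \<longrightarrow> (j \<epsilon> s \<longleftrightarrow> j \<epsilon> t))"
    proof
      assume eq: "bin s (succ k) = bin t (succ k)"
      have n: "add (two_pow k) (bin s k) \<noteq> bin t k" for s t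
        using add_not_mem[OF o] bin_less[OF k] by metis
      have "(k \<epsilon> s \<longleftrightarrow> k \<epsilon> t) \<and> bin s k = bin t k"
        using eq n[of s t] n[of t s, symmetric] add_inj[OF o o, of "two_pow k" s t]
        unfolding bin_succ[OF k bin_less[OF k]] by (simp split: if_splits)
      with IH show "\<forall>j. j \<epsilon> succ k \<longrightarrow> (j \<epsilon> s \<longleftrightarrow> j \<epsilon> t)"
        by (auto simp: mem_succ)
    qed
  qed (intro defn, simp add: mem_emp)
  then show ?thesis using assms by blast
qed

lemma finite_subset_omega:
  assumes "is_finite s" "subset s omega"
  shows "\<exists>n. n \<epsilon> omega \<and> subset s n"
proof -
  have "subset s omega \<longrightarrow> (\<exists>n. n \<epsilon> omega \<and> subset s n)"
  proof (rule finite_induct[where Q = "\<lambda>s. subset s omega \<longrightarrow> (\<exists>n. n \<epsilon> omega \<and> subset s n)", OF _ _ _ assms(1)])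
    fix a s assume IH: "subset s omega \<longrightarrow> (\<exists>n. n \<epsilon> omega \<and> subset s n)"
    show "subset (ins a s) omega \<longrightarrow> (\<exists>n. n \<epsilon> omega \<and> subset (ins a s) n)"
    proof
      assume s: "subset (ins a s) omega"
      then obtain n where n: "n \<epsilon> omega" "subset s n" "a \<epsilon> omega"
        using IH by (auto simp: subset_def mem_ins)
      show "\<exists>n. n \<epsilon> omega \<and> subset (ins a s) n"
      proof (cases "n \<epsilon> a")
        case True
        then have "subset (ins a s) (succ a)"
          using n(2) Ord_trans[OF omega_Ord[OF n(3)] True] by (auto simp: subset_def mem_ins mem_succ)
        then show ?thesis using succ_omega[OF n(3)] by blast
      next
        case False
        then have "a \<epsilon> succ n"
          using Ord_linear[OF omega_Ord[OF n(1)] omega_Ord[OF n(3)]] mem_succ by metis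
        then have "subset (ins a s) (succ n)"
          using n(2) by (auto simp: subset_def mem_ins mem_succ)
        then show ?thesis using succ_omega[OF n(1)] by blast
      qed
    qed
  qed (intro defn, use emp_omega in \<open>auto simp: subset_def mem_emp\<close>)
  then show ?thesis using assms(2) by blast
qed

lemma bin_omega:
  assumes n: "n \<epsilon> omega" "subset s n"
  shows "bin s omega = bin s n"
  using n omega_Ord[OF n(1)] Ord_trans[OF Ord_omega n(1)]
  by (intro extI) (auto simp: mem_bin Ord_omega subset_def)

text \<open>The explicit starting point of the uniform coding. Two finite sets have a common finite
  bound \<open>n\<close>, and equal values there force equal digits.\<close>

lemma fin_omega_injection: "is_injection (lam (fin omega) (\<lambda>s. bin s omega)) (fin omega) omega"
proof (rule lam_injection)
  show "tm (\<lambda>e. bin (e 0) omega)" by (intro defn)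
  show "bin s omega \<epsilon> omega" if "s \<epsilon> fin omega" for s
    using that finite_subset_omega bin_omega bin_less two_pow_omega Ord_trans[OF Ord_omega]
    unfolding mem_fin by metis
  fix s t assume st: "s \<epsilon> fin omega" "t \<epsilon> fin omega" "bin s omega = bin t omega"
  then have "is_finite (cup s t)" "subset (cup s t) omega"
    using finite_cup by (auto simp: mem_fin subset_def mem_cup)
  from finite_subset_omega[OF this] obtain n where n: "n \<epsilon> omega" "subset s n" "subset t n"
    by (auto simp: subset_def mem_cup)
  then have "bin s n = bin t n" using st(3) bin_omega by metis
  from bin_inj[OF n(1) this] show "s = t"
    using n by (intro extI) (auto simp: subset_def)
qed

section \<open>Coding finite sets of ordinals\<close>

text \<open>A coding \<open>q\<close> defined on \<open>fin\<close> of \<delta> determines \<delta>,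
  because every point of \<delta> lies in a singleton of the domain. So \<open>q\<close> alone
  carries both the ordinal and the injection.\<close>

definition dl :: "'v \<Rightarrow> 'v" where
  "dl q = coll (\<lambda>x. \<exists>s y. opair s y \<epsilon> q \<and> x \<epsilon> s)"

text \<open>The Kuratowski pair, with finite sets replaced by their codes.\<close>

definition pr :: "'v \<Rightarrow> 'v \<Rightarrow> 'v \<Rightarrow> 'v" where
  "pr q x y = app q (upair (app q (upair x x)) (app q (upair x y)))"

definition low :: "'v \<Rightarrow> 'v \<Rightarrow> 'v" where "low d s = coll (\<lambda>x. x \<epsilon> d \<and> x \<epsilon> s)"

definition high :: "'v \<Rightarrow> 'v \<Rightarrow> 'v" where "high d s = coll (\<lambda>x. x \<epsilon> d \<and> add d x \<epsilon> s)"

text \<open>A subset of \<open>\<delta> + \<delta>\<close> is a pair of subsets of \<open>\<delta>\<close>, so \<open>code q\<close> still has values below \<open>\<delta>\<close>.\<close>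

definition code :: "'v \<Rightarrow> 'v \<Rightarrow> 'v" where
  "code q s = pr q (app q (low (dl q) s)) (app q (high (dl q) s))"

definition dbl :: "'v \<Rightarrow> 'v" where "dbl q = add (dl q) (dl q)"

text \<open>Sets already coded keep their codes and the others get codes in the upper half of
  \<delta> + \<delta>. The step thus extends \<open>q\<close> as a set of pairs, and unions can be
  taken at limits.\<close>

definition step :: "'v \<Rightarrow> 'v" where
  "step q = coll (\<lambda>p. p \<epsilon> q \<or>
     (\<exists>s. s \<epsilon> fin (dbl q) \<and> \<not> subset s (dl q) \<and> p = opair s (add (dl q) (code q s))))"

definition good :: "'v \<Rightarrow> bool" where
  "good q \<longleftrightarrow> Ord (dl q) \<and> subset omega (dl q) \<and> is_injection q (fin (dl q)) (dl q)"

lemma dl_tm [defn]: "tm s \<Longrightarrow> tm (\<lambda>e. dl (s e))"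
  by (rule tm1[where F = dl]) (simp only: dl_def, intro defn)
lemma pr_tm [defn]: "tm s \<Longrightarrow> tm t \<Longrightarrow> tm u \<Longrightarrow> tm (\<lambda>e. pr (s e) (t e) (u e))"
  by (rule tm3[where F = pr]) (simp only: pr_def, intro defn)
lemma low_tm [defn]: "tm s \<Longrightarrow> tm t \<Longrightarrow> tm (\<lambda>e. low (s e) (t e))"
  by (rule tm2[where F = low]) (simp only: low_def, intro defn)
lemma high_tm [defn]: "tm s \<Longrightarrow> tm t \<Longrightarrow> tm (\<lambda>e. high (s e) (t e))"
  by (rule tm2[where F = high]) (simp only: high_def, intro defn)
lemma code_tm [defn]: "tm s \<Longrightarrow> tm t \<Longrightarrow> tm (\<lambda>e. code (s e) (t e))"
  by (rule tm2[where F = code]) (simp only: code_def, intro defn)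
lemma dbl_tm [defn]: "tm s \<Longrightarrow> tm (\<lambda>e. dbl (s e))"
  by (rule tm1[where F = dbl]) (simp only: dbl_def, intro defn)
lemma step_tm [defn]: "tm s \<Longrightarrow> tm (\<lambda>e. step (s e))"
  by (rule tm1[where F = step]) (simp only: step_def, intro defn)

lemma upair_eq_iff: "upair a b = upair c d \<longleftrightarrow> a = c \<and> b = d \<or> a = d \<and> b = c"
proof
  assume "upair a b = upair c d"
  then have "x = a \<or> x = b \<longleftrightarrow> x = c \<or> x = d" for x
    unfolding eq_upair_iff mem_upair by blast
  from this[of a] this[of b] this[of c] this[of d] show "a = c \<and> b = d \<or> a = d \<and> b = c"
    by auto
qed (auto simp: eq_upair_iff mem_upair)

lemma mem_dl: "x \<epsilon> dl q \<longleftrightarrow> (\<exists>s y. opair s y \<epsilon> q \<and> x \<epsilon> s)"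
  unfolding dl_def
proof (rule mem_bounded[where x = "sUn (sUn (sUn q))"])
  fix x assume "\<exists>s y. opair s y \<epsilon> q \<and> x \<epsilon> s"
  then obtain s y where "opair s y \<epsilon> q" "x \<epsilon> s" by blast
  moreover have "upair s s \<epsilon> opair s y" "s \<epsilon> upair s s"
    by (auto simp: opair_def mem_upair)
  ultimately show "x \<epsilon> sUn (sUn (sUn q))"
    unfolding mem_sUn by blast
qed (intro defn)

lemma mem_low: "x \<epsilon> low d s \<longleftrightarrow> x \<epsilon> d \<and> x \<epsilon> s"
  unfolding low_def by (rule mem_sep) (intro defn)

lemma mem_high: "x \<epsilon> high d s \<longleftrightarrow> x \<epsilon> d \<and> add d x \<epsilon> s"
  unfolding high_def by (rule mem_sep) (intro defn)

lemma mem_step: "p \<epsilon> step q \<longleftrightarrow> p \<epsilon> q \<or>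
     (\<exists>s. s \<epsilon> fin (dbl q) \<and> \<not> subset s (dl q) \<and> p = opair s (add (dl q) (code q s)))"
proof -
  have t: "tm (\<lambda>e. opair (e 0) (add (dl q) (code q (e 0))))" by (intro defn)
  show ?thesis
    unfolding step_def
    by (rule mem_bounded[where x = "cup q (img (fin (dbl q)) (\<lambda>s. opair s (add (dl q) (code q s))))"])
       (intro defn, auto simp: mem_cup mem_img[OF t])
qed

lemma mem_dbl: "Ord (dl q) \<Longrightarrow> x \<epsilon> dbl q \<longleftrightarrow> x \<epsilon> dl q \<or> (\<exists>y. y \<epsilon> dl q \<and> x = add (dl q) y)"
  unfolding dbl_def by (rule mem_add)

lemma upair_fin: "x \<epsilon> a \<Longrightarrow> y \<epsilon> a \<Longrightarrow> upair x y \<epsilon> fin a"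
  by (auto simp: mem_fin finite_upair subset_def mem_upair)

section \<open>Doubling the domain of a coding\<close>

context
  fixes q
  assumes q: "good q"
begin

lemma Ord_dl: "Ord (dl q)" using q good_def by blast
lemma omega_dl: "n \<epsilon> omega \<Longrightarrow> n \<epsilon> dl q" using q unfolding good_def subset_def by blast
lemma good_inj: "is_injection q (fin (dl q)) (dl q)" using q good_def by blast

lemmas good_app = injection_app[OF good_inj]

lemma pr_mem: "x \<epsilon> dl q \<Longrightarrow> y \<epsilon> dl q \<Longrightarrow> pr q x y \<epsilon> dl q"
  unfolding pr_def by (intro good_app(1) upair_fin)

lemma pr_inj:
  assumes "x \<epsilon> dl q" "y \<epsilon> dl q" "x' \<epsilon> dl q" "y' \<epsilon> dl q" "pr q x y = pr q x' y'"
  shows "x = x' \<and> y = y'"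
proof -
  have "upair (app q (upair x x)) (app q (upair x y)) = upair (app q (upair x' x')) (app q (upair x' y'))"
    using assms(5) unfolding pr_def by (rule good_app(2)[rotated 2]) (intro good_app(1) upair_fin assms)+
  moreover have "app q (upair a b) = app q (upair c d) \<longleftrightarrow> upair a b = upair c d"
    if "a \<epsilon> dl q" "b \<epsilon> dl q" "c \<epsilon> dl q" "d \<epsilon> dl q" for a b c d
    using good_app(2)[OF upair_fin[OF that(1,2)] upair_fin[OF that(3,4)]] by auto
  ultimately show ?thesis
    using assms(1-4) by (auto simp: upair_eq_iff)
qed

lemma low_fin: "s \<epsilon> fin (dbl q) \<Longrightarrow> low (dl q) s \<epsilon> fin (dl q)"
  unfolding mem_fin using finite_subset[of s "low (dl q) s"] by (auto simp: subset_def mem_low)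

lemma high_fin:
  assumes "s \<epsilon> fin (dbl q)"
  shows "high (dl q) s \<epsilon> fin (dl q)"
proof -
  have "is_finite (high (dl q) s)"
  proof (rule finite_inj[where F = "add (dl q)"])
    show "x = y" if "x \<epsilon> high (dl q) s" "y \<epsilon> high (dl q) s" "add (dl q) x = add (dl q) y" for x y
      using that add_inj Ord_mem[OF Ord_dl] by (auto simp: mem_high)
  qed (use assms in \<open>auto simp: mem_fin mem_high intro: defn\<close>)
  then show ?thesis by (auto simp: mem_fin subset_def mem_high)
qed

lemma code_mem: "s \<epsilon> fin (dbl q) \<Longrightarrow> code q s \<epsilon> dl q"
  unfolding code_def by (intro pr_mem good_app(1) low_fin high_fin)

lemma code_inj:
  assumes "s \<epsilon> fin (dbl q)" "t \<epsilon> fin (dbl q)" "code q s = code q t"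
  shows "s = t"
proof -
  have "low (dl q) s = low (dl q) t" "high (dl q) s = high (dl q) t"
    using pr_inj[OF _ _ _ _ assms(3)[unfolded code_def]] good_app low_fin high_fin assms(1,2) by metis+
  then have *: "x \<epsilon> dl q \<Longrightarrow> x \<epsilon> s \<longleftrightarrow> x \<epsilon> t" "x \<epsilon> dl q \<Longrightarrow> add (dl q) x \<epsilon> s \<longleftrightarrow> add (dl q) x \<epsilon> t" for x
    using mem_low mem_high by metis+
  have "x \<epsilon> dbl q \<Longrightarrow> x \<epsilon> s \<longleftrightarrow> x \<epsilon> t" for x
    unfolding mem_dbl[OF Ord_dl] using * by blast
  then show ?thesis
    using assms(1,2) unfolding mem_fin subset_def by (intro extI) blast
qed

lemma dl_step: "dl (step q) = dbl q"
proof (rule extI)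
  have d: "opair s y \<epsilon> q \<Longrightarrow> subset s (dl q)" for s y
    by (auto simp: mem_dl subset_def)
  have b: "x \<epsilon> dl q \<Longrightarrow> x \<epsilon> dbl q" for x
    by (simp add: mem_dbl[OF Ord_dl])
  fix x
  show "x \<epsilon> dl (step q) \<longleftrightarrow> x \<epsilon> dbl q"
  proof
    assume "x \<epsilon> dl (step q)"
    then show "x \<epsilon> dbl q"
      using b d unfolding mem_dl[of x "step q"] mem_step opair_eq_iff mem_fin subset_def by blast
  next
    assume x: "x \<epsilon> dbl q"
    \<comment> \<open>The singleton of \<open>x\<close> witnesses that the new domain contains
      \<open>x\<close>.\<close>
    then have "upair x x \<epsilon> fin (dbl q)" by (intro upair_fin)
    then show "x \<epsilon> dl (step q)"
    proof (cases "x \<epsilon> dl q")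
      case True
      then show ?thesis using mem_dl mem_step by blast
    next
      case False
      then have "\<not> subset (upair x x) (dl q)" by (simp add: subset_def mem_upair)
      with \<open>upair x x \<epsilon> fin (dbl q)\<close> have "opair (upair x x) (add (dl q) (code q (upair x x))) \<epsilon> step q"
        unfolding mem_step by blast
      then show ?thesis
        unfolding mem_dl[of x] using mem_upair by blast
    qed
  qed
qed

lemma opair_step:
  "opair s y \<epsilon> step q \<longleftrightarrow> s \<epsilon> fin (dbl q) \<and>
    y = (if subset s (dl q) then app q s else add (dl q) (code q s))"
proof -
  have "is_function q (fin (dl q)) (dl q)" using good_inj is_injection_def by blast
  note f = function_pair[OF this]
  have "s \<epsilon> fin (dl q) \<longleftrightarrow> s \<epsilon> fin (dbl q) \<and> subset s (dl q)"
    by (auto simp: mem_fin subset_def mem_dbl[OF Ord_dl])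
  then show ?thesis
    unfolding mem_step opair_eq_iff f by auto
qed

lemma good_step: "good (step q)"
  unfolding good_def dl_step
proof (intro conjI)
  show "Ord (dbl q)" unfolding dbl_def by (intro Ord_add Ord_dl)
  show "subset omega (dbl q)"
    using omega_dl by (auto simp: subset_def mem_dbl[OF Ord_dl])
  let ?F = "\<lambda>s. if subset s (dl q) then app q s else add (dl q) (code q s)"
  have fin: "s \<epsilon> fin (dbl q) \<Longrightarrow> subset s (dl q) \<Longrightarrow> s \<epsilon> fin (dl q)" for s
    by (auto simp: mem_fin)
  have F: "?F s \<epsilon> dbl q" if "s \<epsilon> fin (dbl q)" for s
    using good_app(1)[OF fin[OF that]] code_mem[OF that] by (auto simp: mem_dbl[OF Ord_dl])
  have "is_function (step q) (fin (dbl q)) (dbl q)"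
    unfolding is_function_def
  proof (intro conjI allI impI)
    fix p assume p: "p \<epsilon> step q"
    have "is_function q (fin (dl q)) (dl q)" using good_inj is_injection_def by blast
    then obtain s y where sy: "p = opair s y"
      using p unfolding mem_step is_function_def by blast
    have "s \<epsilon> fin (dbl q)" "y = ?F s"
      using p unfolding sy opair_step by simp_all
    with F sy show "\<exists>s y. s \<epsilon> fin (dbl q) \<and> y \<epsilon> dbl q \<and> p = opair s y"
      by blast
  qed (simp add: opair_step)
  moreover have "s = t" if st: "opair s y \<epsilon> step q" "opair t y \<epsilon> step q" for s t y
  proof -
    \<comment> \<open>Old codes lie below \<delta> and new ones do not, so equal values come from
      two old sets or from two new ones.\<close>
    have n: "app q s \<noteq> add (dl q) (code q t)" if "s \<epsilon> fin (dl q)" "t \<epsilon> fin (dbl q)" for s t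
      using good_app(1)[OF that(1)] add_not_mem Ord_mem[OF Ord_dl code_mem[OF that(2)]] by metis
    have o: "s \<epsilon> fin (dbl q) \<Longrightarrow> Ord (code q s)" for s
      using Ord_mem[OF Ord_dl] code_mem by blast
    have s: "s \<epsilon> fin (dbl q)" "t \<epsilon> fin (dbl q)" and eq: "?F s = ?F t"
      using st unfolding opair_step by simp_all
    show ?thesis
      using eq n[OF fin[OF s(1)] s(2)] n[OF fin[OF s(2)] s(1), symmetric]
        good_app(2)[OF fin[OF s(1)] fin[OF s(2)]] add_inj[OF o[OF s(1)] o[OF s(2)]] code_inj[OF s]
      by (simp split: if_splits)
  qed
  ultimately show "is_injection (step q) (fin (dbl q)) (dbl q)"
    unfolding is_injection_def by blast
qed

end

section \<open>Codings for arbitrary infinite ordinals\<close>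

lemma dl_mono: "subset p q \<Longrightarrow> subset (dl p) (dl q)"
  unfolding subset_def mem_dl by blast

text \<open>In a chain of codings a finite subset of the union of the domains lies inside a single
  domain, and any two pairs lie in a single member. Totality, uniqueness of values and injectivity
  therefore pass to the union.\<close>

lemma good_sUn:
  assumes q: "q \<epsilon> C" and good: "\<And>q. q \<epsilon> C \<Longrightarrow> good q"
    and chain: "\<And>p q. p \<epsilon> C \<Longrightarrow> q \<epsilon> C \<Longrightarrow> subset p q \<or> subset q p"
  shows "good (sUn C)"
proof -
  have dl: "x \<epsilon> dl (sUn C) \<longleftrightarrow> (\<exists>q. q \<epsilon> C \<and> x \<epsilon> dl q)" for x
    unfolding mem_dl mem_sUn by blast
  have fin: "\<exists>q. q \<epsilon> C \<and> s \<epsilon> fin (dl q)" if "s \<epsilon> fin (dl (sUn C))" for s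
  proof -
    have "subset s (dl (sUn C)) \<longrightarrow> (\<exists>q. q \<epsilon> C \<and> subset s (dl q))"
    proof (rule finite_induct[where Q = "\<lambda>s. subset s (dl (sUn C)) \<longrightarrow> (\<exists>q. q \<epsilon> C \<and> subset s (dl q))"])
      show "is_finite s" using that mem_fin by blast
      show "subset emp (dl (sUn C)) \<longrightarrow> (\<exists>q. q \<epsilon> C \<and> subset emp (dl q))"
        using q by (auto simp: subset_def mem_emp)
      fix a X assume IH: "subset X (dl (sUn C)) \<longrightarrow> (\<exists>q. q \<epsilon> C \<and> subset X (dl q))"
      show "subset (ins a X) (dl (sUn C)) \<longrightarrow> (\<exists>q. q \<epsilon> C \<and> subset (ins a X) (dl q))"
      proof
        assume a: "subset (ins a X) (dl (sUn C))"
        then obtain p where p: "p \<epsilon> C" "subset X (dl p)"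
          using IH unfolding subset_def mem_ins by blast
        obtain q where q: "q \<epsilon> C" "a \<epsilon> dl q"
          using a unfolding subset_def mem_ins dl by blast
        show "\<exists>q. q \<epsilon> C \<and> subset (ins a X) (dl q)"
          using chain[OF p(1) q(1)] dl_mono[of p q] dl_mono[of q p] p q
          unfolding subset_def[of _ "dl _"] mem_ins by metis
      qed
    qed (intro defn)
    then show ?thesis using that unfolding mem_fin by blast
  qed
  have ff: "is_function q (fin (dl q)) (dl q)" if "q \<epsilon> C" for q
    using good[OF that] unfolding good_def is_injection_def by blast
  have two: "\<exists>q. q \<epsilon> C \<and> x \<epsilon> q \<and> y \<epsilon> q" if "x \<epsilon> sUn C" "y \<epsilon> sUn C" for x y
    using that chain unfolding mem_sUn subset_def by blast
  have "Ord (dl (sUn C))"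
  proof (rule OrdI)
    fix b c assume "b \<epsilon> dl (sUn C)" "c \<epsilon> b"
    then show "c \<epsilon> dl (sUn C)"
      unfolding dl using good Ord_trans unfolding good_def by blast
  next
    fix b assume "b \<epsilon> dl (sUn C)"
    then show "Ord b"
      unfolding dl using good Ord_mem unfolding good_def by blast
  qed
  moreover have "subset omega (dl (sUn C))"
    using good[OF q] q unfolding good_def subset_def dl by blast
  moreover have "is_function (sUn C) (fin (dl (sUn C))) (dl (sUn C))"
    unfolding is_function_def
  proof (intro conjI allI impI)
    fix p assume "p \<epsilon> sUn C"
    then obtain q where "q \<epsilon> C" "p \<epsilon> q" unfolding mem_sUn by blast
    with ff[OF this(1)] obtain x y where "x \<epsilon> fin (dl q)" "y \<epsilon> dl q" "p = opair x y"
      unfolding is_function_def by blast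
    with \<open>q \<epsilon> C\<close> show "\<exists>x y. x \<epsilon> fin (dl (sUn C)) \<and> y \<epsilon> dl (sUn C) \<and> p = opair x y"
      unfolding mem_fin dl subset_def by blast
  next
    fix s assume "s \<epsilon> fin (dl (sUn C))"
    then obtain q where "q \<epsilon> C" "s \<epsilon> fin (dl q)" using fin by blast
    then have "opair s (app q s) \<epsilon> sUn C"
      using function_app[OF ff] unfolding mem_sUn by blast
    moreover have "y = y'" if "opair s y \<epsilon> sUn C" "opair s y' \<epsilon> sUn C" for y y'
      using two[OF that] function_pair[OF ff] by metis
    ultimately show "\<exists>!y. opair s y \<epsilon> sUn C" by blast
  qed
  moreover have "s = t" if "opair s y \<epsilon> sUn C" "opair t y \<epsilon> sUn C" for s t y
    using two[OF that] good unfolding good_def is_injection_def by blast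
  ultimately show ?thesis
    unfolding good_def is_injection_def by blast
qed

definition stage :: "'v \<Rightarrow> 'v" where
  "stage = chain step (lam (fin omega) (\<lambda>s. bin s omega))"

lemma stage_tm [defn]: "tm s \<Longrightarrow> tm (\<lambda>e. stage (s e))"
  unfolding stage_def by (rule chain_tm) (intro defn)+

lemma mem_stage:
  "Ord a \<Longrightarrow> z \<epsilon> stage a \<longleftrightarrow>
    z \<epsilon> lam (fin omega) (\<lambda>s. bin s omega) \<or> (\<exists>m. m \<epsilon> a \<and> z \<epsilon> step (stage m))"
  unfolding stage_def by (rule mem_chain) (intro defn)

lemma dl_base: "dl (lam (fin omega) (\<lambda>s. bin s omega)) = omega"
proof (rule extI)
  have t: "tm (\<lambda>e. bin (e 0) omega)" by (intro defn)
  fix x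
  have "x \<epsilon> omega \<Longrightarrow> \<exists>s. s \<epsilon> fin omega \<and> x \<epsilon> s"
    using upair_fin mem_upair by blast
  then show "x \<epsilon> dl (lam (fin omega) (\<lambda>s. bin s omega)) \<longleftrightarrow> x \<epsilon> omega"
    unfolding mem_dl mem_lam[OF t] opair_eq_iff by (auto simp: mem_fin subset_def)
qed

lemma good_base: "good (lam (fin omega) (\<lambda>s. bin s omega))"
  unfolding good_def dl_base using Ord_omega fin_omega_injection by (simp add: subset_def)

lemma good_stage:
  assumes "Ord a"
  shows "good (stage a)"
proof (rule Ord_induct[where Q = "\<lambda>a. good (stage a)", OF _ _ assms])
  show "pdef (\<lambda>e. good (stage (e 0)))"
    unfolding good_def by (intro defn)
  fix a assume a: "Ord a" and IH: "\<And>m. m \<epsilon> a \<Longrightarrow> good (stage m)"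
  let ?b = "lam (fin omega) (\<lambda>s. bin s omega)"
  have t: "tm (\<lambda>e. step (stage (e 0)))" by (intro defn)
  let ?C = "ins ?b (img a (\<lambda>m. step (stage m)))"
  have C: "x \<epsilon> ?C \<longleftrightarrow> x = ?b \<or> (\<exists>m. m \<epsilon> a \<and> x = step (stage m))" for x
    by (simp add: mem_ins mem_img[OF t])
  have o: "Ord m" if "m \<epsilon> a" for m using that a Ord_mem by blast
  have bs: "subset ?b (step (stage m))" if "m \<epsilon> a" for m
    unfolding subset_def mem_step mem_stage[OF o[OF that]] by blast
  have ss: "subset (step (stage m)) (step (stage n))" if "n \<epsilon> a" "m \<epsilon> n" for m n
    unfolding subset_def mem_step[of _ "stage n"] mem_stage[OF o[OF that(1)]] using that(2) by blast
  have "good (sUn ?C)"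
  proof (rule good_sUn)
    show "?b \<epsilon> ?C" by (simp add: C)
    show "good q" if "q \<epsilon> ?C" for q
      using that good_base good_step IH unfolding C by blast
    show "subset p q \<or> subset q p" if p: "p \<epsilon> ?C" and q: "q \<epsilon> ?C" for p q
    proof -
      have r: "subset x x" for x by (simp add: subset_def)
      have "subset (step (stage m)) (step (stage n)) \<or> subset (step (stage n)) (step (stage m))"
        if "m \<epsilon> a" "n \<epsilon> a" for m n
        using Ord_linear[OF o[OF that(1)] o[OF that(2)]] ss that r by blast
      then show ?thesis
        using p q bs r unfolding C by blast
    qed
  qed
  moreover have "stage a = sUn ?C"
    by (rule extI) (unfold mem_stage[OF a] mem_sUn C, blast)
  ultimately show "good (stage a)" by simp
qed

lemma mem_dl_stage:
  assumes "Ord a"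
  shows "x \<epsilon> dl (stage a) \<longleftrightarrow> x \<epsilon> omega \<or> (\<exists>m. m \<epsilon> a \<and> x \<epsilon> dbl (stage m))"
proof -
  have "x \<epsilon> dl (stage a) \<longleftrightarrow> x \<epsilon> dl (lam (fin omega) (\<lambda>s. bin s omega)) \<or>
      (\<exists>m. m \<epsilon> a \<and> x \<epsilon> dl (step (stage m)))"
    unfolding mem_dl mem_stage[OF assms] by blast
  then show ?thesis
    unfolding dl_base using dl_step[OF good_stage] Ord_mem[OF assms] by metis
qed

text \<open>Every step enlarges the domain strictly, so the domains outgrow every ordinal.\<close>

lemma stage_bound:
  assumes "Ord a"
  shows "subset a (dl (stage a))"
proof (rule Ord_induct[where Q = "\<lambda>a. subset a (dl (stage a))", OF _ _ assms])
  fix a assume a: "Ord a" and IH: "\<And>m. m \<epsilon> a \<Longrightarrow> subset m (dl (stage m))"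
  have "m \<epsilon> dl (stage a)" if m: "m \<epsilon> a" for m
  proof -
    note o = Ord_mem[OF a m]
    note d = Ord_dl[OF good_stage[OF o]]
    have "emp \<epsilon> dl (stage m)"
      by (rule omega_dl[OF good_stage[OF o] emp_omega])
    \<comment> \<open>\<delta> is \<delta> + 0, and 0 belongs to \<delta>; so \<delta> itself lies
      in \<delta> + \<delta>.\<close>
    then have "dl (stage m) \<epsilon> dbl (stage m)"
      unfolding mem_dbl[OF d] using add_emp by metis
    moreover have "m = dl (stage m) \<or> m \<epsilon> dl (stage m)"
      using IH[OF m] Ord_subset[OF o d] by blast
    ultimately have "m \<epsilon> dbl (stage m)"
      unfolding mem_dbl[OF d] by metis
    then show ?thesis unfolding mem_dl_stage[OF a] using m by blast
  qed
  then show "subset a (dl (stage a))" unfolding subset_def by blast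
qed (intro defn)

text \<open>Taking the first stage whose doubled domain contains \<open>t\<close> ensures that its own domain is at most \<open>t\<close>.\<close>

definition coding :: "'v \<Rightarrow> 'v" where
  "coding t = coll (\<lambda>z. \<exists>m. Ord m \<and> t \<epsilon> dbl (stage m) \<and>
     (\<forall>n. n \<epsilon> m \<longrightarrow> \<not> t \<epsilon> dbl (stage n)) \<and> z \<epsilon> stage m)"

lemma coding_tm [defn]: "tm s \<Longrightarrow> tm (\<lambda>e. coding (s e))"
  by (rule tm1[where F = coding]) (simp only: coding_def, intro defn)

lemma coding:
  assumes t: "Ord t" "subset omega t"
  shows "good (coding t)" "subset (dl (coding t)) t" "subset t (dbl (coding t))"
proof -
  have "t \<epsilon> dl (stage (succ t))"
    using stage_bound[OF Ord_succ[OF t(1)]] by (simp add: subset_def mem_succ)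
  moreover have "\<not> t \<epsilon> omega"
    using t(2) no_self unfolding subset_def by blast
  ultimately obtain m where "m \<epsilon> succ t" "t \<epsilon> dbl (stage m)"
    unfolding mem_dl_stage[OF Ord_succ[OF t(1)]] by blast
  moreover have "pdef (\<lambda>e. t \<epsilon> dbl (stage (e 0)))" by (intro defn)
  ultimately obtain m where m: "Ord m" "t \<epsilon> dbl (stage m)" "\<And>n. n \<epsilon> m \<Longrightarrow> \<not> t \<epsilon> dbl (stage n)"
    using Ord_least[where Q = "\<lambda>m. t \<epsilon> dbl (stage m)"] Ord_mem[OF Ord_succ[OF t(1)]] by metis
  \<comment> \<open>The first such stage is unique, so the union over all of them is that
    stage.\<close>
  have "(\<exists>m. Ord m \<and> t \<epsilon> dbl (stage m) \<and> (\<forall>n. n \<epsilon> m \<longrightarrow> \<not> t \<epsilon> dbl (stage n)) \<and> z \<epsilon> stage m)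
      \<longleftrightarrow> z \<epsilon> stage m" for z
    using m Ord_linear[OF m(1)] by metis
  then have "coding t = coll (\<lambda>z. z \<epsilon> stage m)"
    unfolding coding_def by (intro arg_cong[where f = coll] ext)
  also have "\<dots> = stage m" by (intro extI mem_coll) blast
  finally have c: "coding t = stage m" .
  note g = good_stage[OF m(1)] and d = Ord_dl[OF good_stage[OF m(1)]]
  show "good (coding t)" unfolding c by (rule g)
  \<comment> \<open>An element of this domain lies in \<omega> or in an earlier doubled domain. The
    first is impossible for \<open>t\<close>, and the second contradicts the minimality of
    \<open>m\<close>.\<close>
  have "\<not> t \<epsilon> dl (stage m)"
    unfolding mem_dl_stage[OF m(1)] using m(3) \<open>\<not> t \<epsilon> omega\<close> by blast
  then show "subset (dl (coding t)) t"
    unfolding c using Ord_linear[OF t(1) d] Ord_subset[OF d t(1)] by blast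
  have "Ord (dbl (stage m))" unfolding dbl_def by (intro Ord_add d)
  then show "subset t (dbl (coding t))"
    unfolding c using Ord_trans m(2) unfolding subset_def by blast
qed

section \<open>Diagonalization\<close>

text \<open>In the notation of the introduction, \<open>val f h \<xi> = f(X\<^sub>\<xi>)\<close>, \<open>new f h \<xi> = D\<^sub>\<xi>\<close>, \<open>ltyp f \<gamma> h = \<tau>\<close>,
  \<open>touch f \<gamma> h \<xi>\<close> corresponds to \<open>S\<^sub>\<xi>\<close>, and \<open>block f \<gamma> h \<xi> = E\<^sub>\<xi>\<close>, where \<open>h\<close> is the function \<open>\<xi> \<mapsto> X\<^sub>\<xi>\<close>
  on \<open>\<gamma>\<close>.  The order type of \<open>same f \<gamma> h \<xi>\<close> below \<open>\<xi>\<close> makes \<open>key\<close> injective.\<close>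

definition val :: "'v \<Rightarrow> 'v \<Rightarrow> 'v \<Rightarrow> 'v" where
  "val f h x = app f (app h x)"

definition new :: "'v \<Rightarrow> 'v \<Rightarrow> 'v \<Rightarrow> 'v" where
  "new f h x = coll (\<lambda>a. a \<epsilon> val f h x \<and> (\<forall>y. y \<epsilon> x \<longrightarrow> \<not> a \<epsilon> val f h y))"

definition live :: "'v \<Rightarrow> 'v \<Rightarrow> 'v \<Rightarrow> 'v" where
  "live f c h = coll (\<lambda>i. i \<epsilon> c \<and> (\<exists>a. a \<epsilon> new f h i))"

definition touch :: "'v \<Rightarrow> 'v \<Rightarrow> 'v \<Rightarrow> 'v \<Rightarrow> 'v" where
  "touch f c h x = coll (\<lambda>i. i \<epsilon> live f c h \<and> (\<exists>a. a \<epsilon> new f h i \<and> a \<epsilon> val f h x))"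

definition same :: "'v \<Rightarrow> 'v \<Rightarrow> 'v \<Rightarrow> 'v \<Rightarrow> 'v" where
  "same f c h x = coll (\<lambda>y. y \<epsilon> c \<and> touch f c h y = touch f c h x)"

definition ltyp :: "'v \<Rightarrow> 'v \<Rightarrow> 'v \<Rightarrow> 'v" where
  "ltyp f c h = img (live f c h) (otp (live f c h))"

definition key :: "'v \<Rightarrow> 'v \<Rightarrow> 'v \<Rightarrow> 'v \<Rightarrow> 'v \<Rightarrow> 'v" where
  "key f c h x b = pr (coding (ltyp f c h))
     (code (coding (ltyp f c h)) (img (touch f c h x) (otp (live f c h))))
     (pr (coding (ltyp f c h)) (otp (same f c h x) x) b)"

text \<open>An index is recovered from its order type, so the nonempty new sets are addressed by the
  ordinals below \<tau>.\<close>

definition piece :: "'v \<Rightarrow> 'v \<Rightarrow> 'v \<Rightarrow> 'v \<Rightarrow> 'v" where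
  "piece f c h t = coll (\<lambda>a. \<exists>i. i \<epsilon> live f c h \<and> otp (live f c h) i = t \<and> a \<epsilon> new f h i)"

definition block :: "'v \<Rightarrow> 'v \<Rightarrow> 'v \<Rightarrow> 'v \<Rightarrow> 'v" where
  "block f c h x = cup (piece f c h (key f c h x emp)) (piece f c h (key f c h x (succ emp)))"

definition diag :: "'v \<Rightarrow> 'v \<Rightarrow> 'v \<Rightarrow> 'v \<Rightarrow> 'v" where
  "diag A f c h = coll (\<lambda>E. (\<exists>x. x \<epsilon> c \<and> E = block f c h x \<and> \<not> E \<epsilon> app h x) \<or>
     (\<exists>a. a \<epsilon> A \<and> E = upair a a \<and> (\<forall>x. x \<epsilon> c \<longrightarrow> a \<epsilon> block f c h x \<longrightarrow> block f c h x \<epsilon> app h x)))"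

lemma val_tm [defn]: "tm s \<Longrightarrow> tm t \<Longrightarrow> tm (\<lambda>e. val f (s e) (t e))"
  by (rule tm2[where F = "val f"]) (simp only: val_def, intro defn)
lemma new_tm [defn]: "tm s \<Longrightarrow> tm t \<Longrightarrow> tm (\<lambda>e. new f (s e) (t e))"
  by (rule tm2[where F = "new f"]) (simp only: new_def, intro defn)
lemma live_tm [defn]: "tm s \<Longrightarrow> tm t \<Longrightarrow> tm (\<lambda>e. live f (s e) (t e))"
  by (rule tm2[where F = "live f"]) (simp only: live_def, intro defn)
lemma touch_tm [defn]: "tm s \<Longrightarrow> tm t \<Longrightarrow> tm u \<Longrightarrow> tm (\<lambda>e. touch f (s e) (t e) (u e))"
  by (rule tm3[where F = "touch f"]) (simp only: touch_def, intro defn)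
lemma same_tm [defn]: "tm s \<Longrightarrow> tm t \<Longrightarrow> tm u \<Longrightarrow> tm (\<lambda>e. same f (s e) (t e) (u e))"
  by (rule tm3[where F = "same f"]) (simp only: same_def, intro defn)
lemma ltyp_tm [defn]: "tm s \<Longrightarrow> tm t \<Longrightarrow> tm (\<lambda>e. ltyp f (s e) (t e))"
  by (rule tm2[where F = "ltyp f"]) (simp only: ltyp_def, intro defn)
lemma key_tm [defn]: "tm s \<Longrightarrow> tm t \<Longrightarrow> tm u \<Longrightarrow> tm w \<Longrightarrow> tm (\<lambda>e. key f (s e) (t e) (u e) (w e))"
  by (rule tm4[where F = "key f"]) (simp only: key_def, intro defn)
lemma piece_tm [defn]: "tm s \<Longrightarrow> tm t \<Longrightarrow> tm u \<Longrightarrow> tm (\<lambda>e. piece f (s e) (t e) (u e))"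
  by (rule tm3[where F = "piece f"]) (simp only: piece_def, intro defn)
lemma block_tm [defn]: "tm s \<Longrightarrow> tm t \<Longrightarrow> tm u \<Longrightarrow> tm (\<lambda>e. block f (s e) (t e) (u e))"
  by (rule tm3[where F = "block f"]) (simp only: block_def, intro defn)
lemma diag_tm [defn]: "tm s \<Longrightarrow> tm t \<Longrightarrow> tm (\<lambda>e. diag A f (s e) (t e))"
  by (rule tm2[where F = "diag A f"]) (simp only: diag_def, intro defn)

lemma mem_new: "a \<epsilon> new f h x \<longleftrightarrow> a \<epsilon> val f h x \<and> (\<forall>y. y \<epsilon> x \<longrightarrow> \<not> a \<epsilon> val f h y)"
  unfolding new_def by (rule mem_sep) (intro defn)

lemma mem_live: "i \<epsilon> live f c h \<longleftrightarrow> i \<epsilon> c \<and> (\<exists>a. a \<epsilon> new f h i)"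
  unfolding live_def by (rule mem_sep) (intro defn)

lemma mem_touch: "i \<epsilon> touch f c h x \<longleftrightarrow> i \<epsilon> live f c h \<and> (\<exists>a. a \<epsilon> new f h i \<and> a \<epsilon> val f h x)"
  unfolding touch_def by (rule mem_sep) (intro defn)

lemma mem_same: "y \<epsilon> same f c h x \<longleftrightarrow> y \<epsilon> c \<and> touch f c h y = touch f c h x"
  unfolding same_def by (rule mem_sep) (intro defn)

lemma otp_tm_live: "tm (\<lambda>e. otp (live f c h) (e 0))"
  by (intro defn)

lemma mem_ltyp: "t \<epsilon> ltyp f c h \<longleftrightarrow> (\<exists>i. i \<epsilon> live f c h \<and> t = otp (live f c h) i)"
  unfolding ltyp_def by (rule mem_img[OF otp_tm_live])

section \<open>Finiteness of sets of indices\<close>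

context
  fixes A f c h
  assumes f: "is_function f (finitary_partitions A) (fin A)"
    and df: "dedekind_finite_to_one f"
    and c: "Ord c" "\<not> c \<epsilon> omega"
    and h: "\<And>x. x \<epsilon> c \<Longrightarrow> app h x \<epsilon> finitary_partitions A"
    and inj: "\<And>x y. x \<epsilon> c \<Longrightarrow> y \<epsilon> c \<Longrightarrow> app h x = app h y \<Longrightarrow> x = y"
begin

lemma val_fin: "x \<epsilon> c \<Longrightarrow> subset (val f h x) A \<and> is_finite (val f h x)"
  using function_app(2)[OF f h] unfolding val_def mem_fin by blast

lemma live_Ord: "i \<epsilon> live f c h \<Longrightarrow> i \<epsilon> c \<and> Ord i"
  using Ord_mem[OF c(1)] mem_live by blast

text \<open>Take the least index whose value contains \<open>a\<close>; by minimality
  \<open>a\<close> is new there.\<close>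

lemma val_new:
  assumes x: "x \<epsilon> c" "a \<epsilon> val f h x"
  shows "\<exists>i. i \<epsilon> live f c h \<and> a \<epsilon> new f h i"
proof -
  have "pdef (\<lambda>e. a \<epsilon> val f h (e 0))" by (intro defn)
  then obtain i where i: "Ord i" "a \<epsilon> val f h i" "\<And>j. j \<epsilon> i \<Longrightarrow> \<not> a \<epsilon> val f h j"
    using Ord_least[where Q = "\<lambda>i. a \<epsilon> val f h i", OF _ Ord_mem[OF c(1) x(1)] x(2)] by blast
  then have "i \<epsilon> c"
    using Ord_linear[OF i(1) Ord_mem[OF c(1) x(1)]] x Ord_trans[OF c(1)] by blast
  then show ?thesis
    using i unfolding mem_live mem_new by blast
qed

lemma new_disjoint:
  assumes "i \<epsilon> live f c h" "j \<epsilon> live f c h" "a \<epsilon> new f h i" "a \<epsilon> new f h j"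
  shows "i = j"
  using Ord_linear[of i j] live_Ord[OF assms(1)] live_Ord[OF assms(2)] assms(3,4) unfolding mem_new by blast

lemma new_fin:
  assumes "i \<epsilon> live f c h"
  shows "subset (new f h i) A \<and> is_finite (new f h i)"
proof -
  have "subset (new f h i) (val f h i)"
    by (simp add: subset_def mem_new)
  then show ?thesis
    using val_fin live_Ord[OF assms] finite_subset unfolding subset_def by blast
qed

lemma finite_touch:
  assumes x: "x \<epsilon> c"
  shows "is_finite (touch f c h x)"
proof -
  \<comment> \<open>For \<open>a\<close> new at a live index, \<open>idx a\<close> is that index,
    which is unique. So \<open>touch f c h x\<close> is covered by the image of the finite set
    \<open>val f h x\<close>.\<close>
  define idx where "idx a = coll (\<lambda>z. \<exists>i. i \<epsilon> live f c h \<and> a \<epsilon> new f h i \<and> z \<epsilon> i)" for a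
  have t: "tm (\<lambda>e. idx (e 0))" unfolding idx_def by (intro defn)
  have idx: "idx a = i" if "i \<epsilon> live f c h" "a \<epsilon> new f h i" for a i
  proof (rule extI)
    have "z \<epsilon> idx a \<longleftrightarrow> (\<exists>j. j \<epsilon> live f c h \<and> a \<epsilon> new f h j \<and> z \<epsilon> j)" for z
      unfolding idx_def by (rule mem_bounded[where x = i]) (intro defn, use new_disjoint that in blast)
    then show "z \<epsilon> idx a \<longleftrightarrow> z \<epsilon> i" for z
      using new_disjoint that by blast
  qed
  have "subset (touch f c h x) (img (val f h x) idx)"
    unfolding subset_def mem_touch mem_img[OF t] using idx by blast
  then show ?thesis
    using finite_img[OF t] val_fin[OF x] finite_subset by blast
qed

text \<open>This is where \<open>f\<close> being Dedekind finite-to-one enters: an infinite set of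
  indices contains a copy of \<omega>, which \<open>h\<close> carries injectively into one fibre of
  \<open>f\<close>.\<close>

lemma finite_val_fibre:
  assumes J: "subset J c"
  shows "is_finite (coll (\<lambda>x. x \<epsilon> J \<and> val f h x = z))"
proof (rule ccontr)
  let ?K = "coll (\<lambda>x. x \<epsilon> J \<and> val f h x = z)"
  assume inf: "\<not> is_finite ?K"
  have K: "x \<epsilon> ?K \<longleftrightarrow> x \<epsilon> J \<and> val f h x = z" for x
    by (rule mem_sep) (intro defn)
  have Kc: "x \<epsilon> c" if "x \<epsilon> ?K" for x
    using that J unfolding K subset_def by blast
  then have "dedekind_infinite ?K"
    using infinite_dedekind_infinite[OF _ inf] Ord_mem[OF c(1)] by blast
  then obtain u where "is_injection u omega ?K"
    unfolding dedekind_infinite_def by blast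
  note u = injection_app[OF this]
  have fib: "app h (app u n) \<epsilon> fibre f z" if "n \<epsilon> omega" for n
  proof -
    have "val f h (app u n) = z"
      using u(1)[OF that] K by simp
    then show ?thesis
      using function_app(1)[OF f h[OF Kc[OF u(1)[OF that]]]] unfolding mem_fibre val_def by simp
  qed
  have "dedekind_infinite (fibre f z)"
  proof (rule dedekind_infiniteI[where F = "\<lambda>n. app h (app u n)"])
    show "x = y" if "x \<epsilon> omega" "y \<epsilon> omega" "app h (app u x) = app h (app u y)" for x y
      using that inj[OF Kc[OF u(1)] Kc[OF u(1)]] u(2) by blast
  qed (intro defn, rule fib)
  then show False
    using df fib[OF emp_omega] unfolding dedekind_finite_to_one_def mem_fibre by blast
qed

text \<open>Every point of \<open>val f h x\<close> is new at an index that \<open>x\<close>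
  touches, so the value is a subset of a fixed finite union. This leaves finitely many values, each
  taken finitely often. With all live indices as \<open>T\<close> it shows that these are infinite
  in number; with one touched set as \<open>T\<close>, that few indices share it.\<close>

lemma finite_indices:
  assumes T: "is_finite T" "subset T (live f c h)" and J: "subset J c"
    and JT: "\<And>x. x \<epsilon> J \<Longrightarrow> subset (touch f c h x) T"
  shows "is_finite J"
proof (rule finite_fibres[where F = "val f h" and Y = "pow (sUn (img T (new f h)))"])
  have t: "tm (\<lambda>e. new f h (e 0))" by (intro defn)
  show "tm (\<lambda>e. val f h (e 0))" by (intro defn)
  have "is_finite (sUn (img T (new f h)))"
    using T(2) new_fin
    by (intro finite_sUn finite_img t T) (auto simp: mem_img[OF t] subset_def)
  then show "is_finite (pow (sUn (img T (new f h))))" by (rule finite_pow)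
  show "val f h x \<epsilon> pow (sUn (img T (new f h)))" if x: "x \<epsilon> J" for x
    unfolding mem_pow subset_def[of "val f h x"] mem_UN[OF t]
  proof (intro allI impI)
    fix a assume a: "a \<epsilon> val f h x"
    moreover have "x \<epsilon> c" using x J unfolding subset_def by blast
    ultimately obtain i where "i \<epsilon> live f c h" "a \<epsilon> new f h i" using val_new by blast
    with a show "\<exists>i. i \<epsilon> T \<and> a \<epsilon> new f h i"
      using JT[OF x] unfolding subset_def mem_touch by blast
  qed
qed (rule finite_val_fibre[OF J])

lemma infinite_live: "\<not> is_finite (live f c h)"
proof
  assume "is_finite (live f c h)"
  then have "is_finite c"
    by (rule finite_indices) (auto simp: subset_def mem_touch)
  then show False using finite_Ord[OF c(1)] c(2) by blast
qed

text \<open>The order type of a finite set of ordinals is a natural number, hence lies in the domain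
  of every good coding and can be an argument of \<open>pr\<close>.\<close>

lemma same_omega:
  assumes x: "x \<epsilon> c"
  shows "otp (same f c h x) x \<epsilon> omega"
proof -
  let ?J = "same f c h x"
  have t: "tm (\<lambda>e. otp ?J (e 0))" by (intro defn)
  note o = Ord_mem[OF c(1) x]
  have "is_finite ?J"
    by (rule finite_indices[OF finite_touch[OF x]]) (auto simp: subset_def mem_touch mem_same)
  then have "is_finite (img ?J (otp ?J))"
    by (rule finite_img[OF t])
  moreover have "subset (otp ?J x) (img ?J (otp ?J))"
    unfolding subset_def mem_img[OF t] mem_otp[OF o] by blast
  ultimately show ?thesis
    using finite_subset finite_Ord[OF Ord_otp[OF o]] by blast
qed

section \<open>Injective keys below \<tau>\<close>

lemma coding_ltyp:
  "good (coding (ltyp f c h))"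
  "subset (dl (coding (ltyp f c h))) (ltyp f c h)"
  "subset (ltyp f c h) (dbl (coding (ltyp f c h)))"
proof -
  have "Ord (ltyp f c h)" "subset omega (ltyp f c h)"
    unfolding ltyp_def using Ord_otp_img infinite_otp_img[OF _ infinite_live] live_Ord by blast+
  from coding[OF this] show
    "good (coding (ltyp f c h))"
    "subset (dl (coding (ltyp f c h))) (ltyp f c h)"
    "subset (ltyp f c h) (dbl (coding (ltyp f c h)))" .
qed

text \<open>The types form a finite subset of \<tau> and \<tau> \<le> \<delta> + \<delta>, so
  \<open>code\<close> applies even when \<delta> is smaller than \<tau>.\<close>

lemma touch_types_fin:
  assumes "x \<epsilon> c"
  shows "img (touch f c h x) (otp (live f c h)) \<epsilon> fin (dbl (coding (ltyp f c h)))"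
proof -
  let ?S = "img (touch f c h x) (otp (live f c h))"
  have "is_finite ?S" by (rule finite_img[OF otp_tm_live finite_touch[OF assms]])
  moreover have "z \<epsilon> ?S \<Longrightarrow> z \<epsilon> ltyp f c h" for z
    unfolding mem_img[OF otp_tm_live] mem_ltyp using mem_touch by blast
  ultimately show ?thesis
    using coding_ltyp(3) unfolding mem_fin subset_def by blast
qed

lemma touch_types_inj:
  assumes "img (touch f c h x) (otp (live f c h)) = img (touch f c h y) (otp (live f c h))"
  shows "touch f c h x = touch f c h y"
proof -
  have "i \<epsilon> touch f c h x \<longleftrightarrow> i \<epsilon> live f c h \<and>
      otp (live f c h) i \<epsilon> img (touch f c h x) (otp (live f c h))" for i x
  proof -
    have "i = j" if "i \<epsilon> live f c h" "j \<epsilon> touch f c h x" "otp (live f c h) i = otp (live f c h) j" for j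
      using that otp_inj live_Ord unfolding mem_touch by blast
    moreover have "i \<epsilon> touch f c h x \<Longrightarrow> i \<epsilon> live f c h" by (simp add: mem_touch)
    ultimately show ?thesis
      unfolding mem_img[OF otp_tm_live] by blast
  qed
  then show ?thesis
    using assms by (intro extI) simp
qed

lemma key_parts:
  assumes "x \<epsilon> c" "b \<epsilon> omega"
  shows "code (coding (ltyp f c h)) (img (touch f c h x) (otp (live f c h))) \<epsilon> dl (coding (ltyp f c h))"
    "pr (coding (ltyp f c h)) (otp (same f c h x) x) b \<epsilon> dl (coding (ltyp f c h))"
  using code_mem[OF coding_ltyp(1) touch_types_fin[OF assms(1)]] same_omega[OF assms(1)] assms(2)
    pr_mem[OF coding_ltyp(1)] omega_dl[OF coding_ltyp(1)] by blast+

lemma key_mem: "x \<epsilon> c \<Longrightarrow> b \<epsilon> omega \<Longrightarrow> key f c h x b \<epsilon> ltyp f c h"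
  using pr_mem[OF coding_ltyp(1) key_parts] coding_ltyp(2) unfolding key_def subset_def by blast

text \<open>Decoding the outer pair gives the touched set, so \<open>x\<close> and \<open>y\<close>
  belong to the same class \<open>same f c h x\<close>. Decoding the inner pair gives the bit and
  the position inside that class, which determines the index.\<close>

lemma key_inj:
  assumes x: "x \<epsilon> c" "b \<epsilon> omega" and y: "y \<epsilon> c" "d \<epsilon> omega"
    and eq: "key f c h x b = key f c h y d"
  shows "x = y \<and> b = d"
proof -
  note g = coding_ltyp(1)
  have *: "code (coding (ltyp f c h)) (img (touch f c h x) (otp (live f c h))) =
      code (coding (ltyp f c h)) (img (touch f c h y) (otp (live f c h))) \<and>
    pr (coding (ltyp f c h)) (otp (same f c h x) x) b = pr (coding (ltyp f c h)) (otp (same f c h y) y) d"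
    by (rule pr_inj[OF g key_parts[OF x] key_parts[OF y] eq[unfolded key_def]])
  then have t: "touch f c h x = touch f c h y"
    using code_inj[OF g touch_types_fin[OF x(1)] touch_types_fin[OF y(1)]] touch_types_inj by blast
  have n: "otp (same f c h x) x = otp (same f c h y) y \<and> b = d"
    by (rule pr_inj[OF g _ _ _ _ conjunct2[OF *]])
       (intro omega_dl[OF g] same_omega x y)+
  have "same f c h x = same f c h y"
    unfolding same_def t ..
  moreover have "x \<epsilon> same f c h x" "y \<epsilon> same f c h x"
    using x y t by (simp_all add: mem_same)
  ultimately show ?thesis
    using n otp_inj[of x y "same f c h x"] Ord_mem[OF c(1)] x y by simp
qed

section \<open>Pairwise disjoint blocks\<close>

lemma piece:
  assumes "t \<epsilon> ltyp f c h"
  shows "\<exists>i. i \<epsilon> live f c h \<and> t = otp (live f c h) i \<and> piece f c h t = new f h i"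
proof -
  obtain i where i: "i \<epsilon> live f c h" "t = otp (live f c h) i"
    using assms mem_ltyp by blast
  have eq: "otp (live f c h) j = t \<longleftrightarrow> j = i" if "j \<epsilon> live f c h" for j
    using otp_inj[of j i] live_Ord that i by blast
  have "a \<epsilon> piece f c h t \<longleftrightarrow> (\<exists>i. i \<epsilon> live f c h \<and> otp (live f c h) i = t \<and> a \<epsilon> new f h i)" for a
    unfolding piece_def by (rule mem_bounded[where x = "new f h i"]) (intro defn, use eq in blast)
  then have "piece f c h t = new f h i"
    using eq i by (intro extI) blast
  then show ?thesis using i by blast
qed

lemma piece_disjoint:
  assumes "s \<epsilon> ltyp f c h" "t \<epsilon> ltyp f c h" "a \<epsilon> piece f c h s" "a \<epsilon> piece f c h t"
  shows "s = t"
  using piece[OF assms(1)] piece[OF assms(2)] assms(3,4) new_disjoint by metis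

lemma piece_fin:
  assumes "t \<epsilon> ltyp f c h"
  shows "subset (piece f c h t) A" "is_finite (piece f c h t)" "\<exists>a. a \<epsilon> piece f c h t"
  using piece[OF assms] new_fin mem_live by metis+

lemma one_omega: "succ emp \<epsilon> omega" "succ emp \<noteq> emp"
  using succ_omega[OF emp_omega] mem_succ mem_emp by metis+

lemma mem_block:
  "a \<epsilon> block f c h x \<longleftrightarrow> a \<epsilon> piece f c h (key f c h x emp) \<or> a \<epsilon> piece f c h (key f c h x (succ emp))"
  unfolding block_def by (rule mem_cup)

lemma block_disjoint:
  assumes "x \<epsilon> c" "y \<epsilon> c" "a \<epsilon> block f c h x" "a \<epsilon> block f c h y"
  shows "x = y"
proof -
  have "x = y" if "b \<epsilon> omega" "d \<epsilon> omega" "a \<epsilon> piece f c h (key f c h x b)" "a \<epsilon> piece f c h (key f c h y d)" for b d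
    using piece_disjoint[OF key_mem[OF assms(1) that(1)] key_mem[OF assms(2) that(2)] that(3,4)]
      key_inj[OF assms(1) that(1) assms(2) that(2)] by blast
  then show ?thesis
    using assms(3,4) emp_omega one_omega(1) unfolding mem_block by blast
qed

text \<open>The keys for the two bits differ, so their pieces are disjoint as well as nonempty and
  supply two distinct points.\<close>

lemma block_fin:
  assumes "x \<epsilon> c"
  shows "subset (block f c h x) A" "is_finite (block f c h x)"
    "\<exists>a b. a \<epsilon> block f c h x \<and> b \<epsilon> block f c h x \<and> a \<noteq> b"
proof -
  note k = key_mem[OF assms emp_omega] key_mem[OF assms one_omega(1)]
  show "subset (block f c h x) A"
    using piece_fin(1)[OF k(1)] piece_fin(1)[OF k(2)] unfolding subset_def mem_block by blast
  show "is_finite (block f c h x)"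
    unfolding block_def by (intro finite_cup piece_fin k)
  obtain a where a: "a \<epsilon> piece f c h (key f c h x emp)" using piece_fin(3)[OF k(1)] by blast
  obtain b where b: "b \<epsilon> piece f c h (key f c h x (succ emp))" using piece_fin(3)[OF k(2)] by blast
  have "a \<noteq> b"
    using piece_disjoint[OF k, of a] a b key_inj[OF assms emp_omega assms one_omega(1)] one_omega(2) by metis
  with a b show "\<exists>a b. a \<epsilon> block f c h x \<and> b \<epsilon> block f c h x \<and> a \<noteq> b"
    unfolding mem_block by blast
qed

section \<open>The diagonal partition\<close>

lemma mem_diag: "E \<epsilon> diag A f c h \<longleftrightarrow> (\<exists>x. x \<epsilon> c \<and> E = block f c h x \<and> \<not> E \<epsilon> app h x) \<or>
     (\<exists>a. a \<epsilon> A \<and> E = upair a a \<and> (\<forall>x. x \<epsilon> c \<longrightarrow> a \<epsilon> block f c h x \<longrightarrow> block f c h x \<epsilon> app h x))"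
  unfolding diag_def
proof (rule mem_bounded[where x = "pow A"])
  fix E assume "(\<exists>x. x \<epsilon> c \<and> E = block f c h x \<and> \<not> E \<epsilon> app h x) \<or>
     (\<exists>a. a \<epsilon> A \<and> E = upair a a \<and> (\<forall>x. x \<epsilon> c \<longrightarrow> a \<epsilon> block f c h x \<longrightarrow> block f c h x \<epsilon> app h x))"
  then show "E \<epsilon> pow A"
    unfolding mem_pow using block_fin(1) by (auto simp: subset_def mem_upair)
qed (intro defn)

lemma diag_partition: "diag A f c h \<epsilon> finitary_partitions A"
  unfolding mem_finitary_partitions
proof
  show "is_finitary (diag A f c h)"
    unfolding is_finitary_def mem_diag using block_fin(2) finite_upair by blast
  show "is_partition (diag A f c h) A"
    unfolding is_partition_def
  proof (intro conjI allI impI)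
    show "\<exists>a. a \<epsilon> E" if "E \<epsilon> diag A f c h" for E
      using that block_fin(3) mem_upair unfolding mem_diag by metis
    show "\<not> (\<exists>a. a \<epsilon> E \<and> a \<epsilon> E')"
      if "E \<epsilon> diag A f c h \<and> E' \<epsilon> diag A f c h \<and> E \<noteq> E'" for E E'
    proof
      assume "\<exists>a. a \<epsilon> E \<and> a \<epsilon> E'"
      then obtain a where a: "a \<epsilon> E" "a \<epsilon> E'" by blast
      \<comment> \<open>A member through \<open>a\<close> is a block absent from the corresponding
        partition or the singleton of \<open>a\<close>, and the singleton occurs only if no such
        block contains \<open>a\<close>. Together with disjointness of the blocks this leaves one
        member through \<open>a\<close>.\<close>
      have r: "(\<exists>x. x \<epsilon> c \<and> E = block f c h x \<and> \<not> block f c h x \<epsilon> app h x) \<or>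
          E = upair a a \<and> (\<forall>x. x \<epsilon> c \<longrightarrow> a \<epsilon> block f c h x \<longrightarrow> block f c h x \<epsilon> app h x)"
        if "E \<epsilon> diag A f c h" "a \<epsilon> E" for E
        using that unfolding mem_diag by (auto simp: mem_upair)
      show False
        using r[of E] r[of E'] a that block_disjoint by metis
    qed
    show "a \<epsilon> A \<longleftrightarrow> (\<exists>E. E \<epsilon> diag A f c h \<and> a \<epsilon> E)" for a
    proof
      assume a: "a \<epsilon> A"
      show "\<exists>E. E \<epsilon> diag A f c h \<and> a \<epsilon> E"
      proof (cases "\<forall>x. x \<epsilon> c \<longrightarrow> a \<epsilon> block f c h x \<longrightarrow> block f c h x \<epsilon> app h x")
        case True
        with a have "upair a a \<epsilon> diag A f c h" unfolding mem_diag by blast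
        then show ?thesis using mem_upair by blast
      qed (use mem_diag in blast)
    next
      assume "\<exists>E. E \<epsilon> diag A f c h \<and> a \<epsilon> E"
      then show "a \<epsilon> A"
        unfolding mem_diag using block_fin(1) by (auto simp: subset_def mem_upair)
    qed
  qed
qed

text \<open>The block of \<open>x\<close> has two points, so it is no singleton, and it is disjoint
  from the blocks of other indices. It therefore belongs to the diagonal partition exactly when it
  is absent from \<open>app h x\<close>.\<close>

lemma diag_differs:
  assumes x: "x \<epsilon> c"
  shows "diag A f c h \<noteq> app h x"
proof
  assume eq: "diag A f c h = app h x"
  obtain a b where ab: "a \<epsilon> block f c h x" "b \<epsilon> block f c h x" "a \<noteq> b"
    using block_fin(3)[OF x] by blast
  show False
  proof (cases "block f c h x \<epsilon> app h x")
    case False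
    then have "block f c h x \<epsilon> diag A f c h" using x unfolding mem_diag by blast
    with False eq show False by simp
  next
    case True
    then have "block f c h x \<epsilon> diag A f c h" using eq by simp
    then consider y where "y \<epsilon> c" "block f c h x = block f c h y" "\<not> block f c h x \<epsilon> app h y"
      | d where "block f c h x = upair d d"
      unfolding mem_diag by blast
    then show False
    proof cases
      case 1
      then show False using block_disjoint[OF x 1(1) ab(1)] ab True by simp
    next
      case 2
      then show False using ab by (simp add: mem_upair)
    qed
  qed
qed

end

section \<open>The sequence indexed by all ordinals\<close>

definition seq :: "'v \<Rightarrow> 'v \<Rightarrow> 'v \<Rightarrow> 'v \<Rightarrow> 'v" where
  "seq A f g = Rec (\<lambda>p a h. coll (\<lambda>z. a \<epsilon> omega \<and> z \<epsilon> app g a \<or> \<not> a \<epsilon> omega \<and> z \<epsilon> diag A f a h)) emp"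

lemma seq_tm [defn]: "tm s \<Longrightarrow> tm (\<lambda>e. seq A f g (s e))"
  unfolding seq_def by (rule Rec_tm) (intro defn)+

text \<open>Recursion rules must be definable terms, so the switch at \<omega> from \<open>g\<close>
  to diagonalization is made inside a comprehension; it is unfolded to a conditional here.\<close>

lemma seq_eq:
  assumes "Ord a"
  shows "seq A f g a = (if a \<epsilon> omega then app g a else diag A f a (lam a (seq A f g)))"
proof -
  let ?G = "\<lambda>p a h. coll (\<lambda>z. a \<epsilon> omega \<and> z \<epsilon> app g a \<or> \<not> a \<epsilon> omega \<and> z \<epsilon> diag A f a h)"
  have G: "tm (\<lambda>e. ?G (e 0) (e 1) (e 2))" by (intro defn)
  have "seq A f g a = ?G emp a (lam a (seq A f g))"
    unfolding seq_def using Rec_eq[where G = ?G, OF G assms] .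
  also have "\<dots> = coll (\<lambda>z. z \<epsilon> (if a \<epsilon> omega then app g a else diag A f a (lam a (seq A f g))))"
    by (intro arg_cong[where f = coll] HOL.ext) simp
  also have "\<dots> = (if a \<epsilon> omega then app g a else diag A f a (lam a (seq A f g)))"
    by (intro extI mem_coll) blast
  finally show ?thesis .
qed

lemma no_dedekind_finite_to_one:
  assumes "dedekind_infinite (finitary_partitions A)"
    and f: "is_function f (finitary_partitions A) (fin A)" "dedekind_finite_to_one f"
  shows False
proof -
  let ?B = "finitary_partitions A"
  obtain g where "is_injection g omega ?B"
    using assms(1) unfolding dedekind_infinite_def by blast
  note g = injection_app[OF this]
  let ?X = "seq A f g"
  have t: "tm (\<lambda>e. ?X (e 0))" by (intro defn)
  have X: "?X a \<epsilon> ?B \<and> (\<forall>b. b \<epsilon> a \<longrightarrow> ?X b \<noteq> ?X a)" if "Ord a" for a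
  proof (rule Ord_induct[where Q = "\<lambda>a. ?X a \<epsilon> ?B \<and> (\<forall>b. b \<epsilon> a \<longrightarrow> ?X b \<noteq> ?X a)", OF _ _ that])
    fix a assume a: "Ord a" and IH: "\<And>b. b \<epsilon> a \<Longrightarrow> ?X b \<epsilon> ?B \<and> (\<forall>c. c \<epsilon> b \<longrightarrow> ?X c \<noteq> ?X b)"
    show "?X a \<epsilon> ?B \<and> (\<forall>b. b \<epsilon> a \<longrightarrow> ?X b \<noteq> ?X a)"
    proof (cases "a \<epsilon> omega")
      case True
      show ?thesis
      proof (intro conjI allI impI)
        have eq: "?X b = app g b" if "b \<epsilon> omega" for b
          using seq_eq[OF omega_Ord[OF that]] that by simp
        show "?X a \<epsilon> ?B"
          using g(1)[OF True] eq[OF True] by simp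
        fix b assume b: "b \<epsilon> a"
        then have "b \<epsilon> omega" by (rule Ord_trans[OF Ord_omega True])
        then show "?X b \<noteq> ?X a"
          using g(2)[OF _ True] eq b no_self True by metis
      qed
    next
      case False
      have app: "app (lam a ?X) b = ?X b" if "b \<epsilon> a" for b
        by (rule app_lam[OF t that])
      have h: "app (lam a ?X) b \<epsilon> ?B" if "b \<epsilon> a" for b
        using IH[OF that] unfolding app[OF that] by blast
      \<comment> \<open>The induction hypothesis only compares a term with earlier ones; linearity
        of the ordinals turns this into injectivity.\<close>
      have inj: "b = d" if "b \<epsilon> a" "d \<epsilon> a" "app (lam a ?X) b = app (lam a ?X) d" for b d
      proof -
        have "?X b = ?X d" using that(3) unfolding app[OF that(1)] app[OF that(2)] .
        then show ?thesis
          using Ord_linear[OF Ord_mem[OF a that(1)] Ord_mem[OF a that(2)]] IH[OF that(1)] IH[OF that(2)]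
          by auto
      qed
      have eq: "?X a = diag A f a (lam a ?X)"
        using seq_eq[OF a] False by simp
      show ?thesis
        unfolding eq
      proof (intro conjI allI impI)
        show "diag A f a (lam a ?X) \<epsilon> ?B" by (rule diag_partition[OF f a False h inj])
        fix b assume b: "b \<epsilon> a"
        show "?X b \<noteq> diag A f a (lam a ?X)"
          using diag_differs[OF f a False h inj b] unfolding app[OF b] by metis
      qed
    qed
  qed (intro defn)
  \<comment> \<open>The inverse of the sequence, as the union of the unique preimage; outside the
    range it gives the empty set. By Replacement its image on the partitions is a set, and it
    contains every ordinal.\<close>
  define inv where "inv x = coll (\<lambda>z. \<exists>a. Ord a \<and> ?X a = x \<and> z \<epsilon> a)" for x
  have ti: "tm (\<lambda>e. inv (e 0))" unfolding inv_def by (intro defn)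
  have inv: "inv (?X a) = a" if a: "Ord a" for a
  proof (rule extI)
    have "b = a" if "Ord b" "?X b = ?X a" for b
      using X[OF a] X[OF that(1)] Ord_linear[OF a that(1)] that(2) by metis
    then have "(\<exists>b. Ord b \<and> ?X b = ?X a \<and> z \<epsilon> b) \<longleftrightarrow> z \<epsilon> a" for z
      using a by blast
    moreover from this have "z \<epsilon> inv (?X a) \<longleftrightarrow> (\<exists>b. Ord b \<and> ?X b = ?X a \<and> z \<epsilon> b)" for z
      unfolding inv_def by (intro mem_coll) blast
    ultimately show "z \<epsilon> inv (?X a) \<longleftrightarrow> z \<epsilon> a" for z
      by blast
  qed
  have "a \<epsilon> img ?B inv" if "Ord a" for a
    unfolding mem_img[OF ti] using inv[OF that] X[OF that] by metis
  then show False
    using not_set_of_all_ordinals by blast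
qed

end

theorem theorem4p8:
  fixes mem :: "'v \<Rightarrow> 'v \<Rightarrow> bool" and A :: 'v
  assumes "zf_model mem"
    and "set_structure.dedekind_infinite mem (set_structure.finitary_partitions mem A)"
  shows "\<not> (\<exists>f. set_structure.is_function mem f
                    (set_structure.finitary_partitions mem A) (set_structure.fin mem A) \<and>
                 set_structure.dedekind_finite_to_one mem f)"
  using zf_model.no_dedekind_finite_to_one[OF assms] by blast

end
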